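(* Let $(X,\mathcal{V})$ be a semi-coarse space, let $*\in A\subset X$, and let $i:(A,* )\to(X,* )$ and $j:(X,* )\to(X,A)$ be the inclusions. Then for each $n\ge2$ there is a homomorphism $\partial_n:\pi_n^{sc}(X,A,* )\to\pi_{n-1}^{sc}(A,* )$ such that the long sequence $$\cdots\xrightarrow{j_*}\pi_{n+1}^{sc}(X,A,* )\xrightarrow{\partial_{n+1}}\pi_n^{sc}(A,* )\xrightarrow{i_*}\pi_n^{sc}(X,* )\xrightarrow{j_*}\cdots\xrightarrow{\partial_2}\pi_1^{sc}(A,* )\xrightarrow{i_*}\pi_1^{sc}(X,* )\xrightarrow{j_*}\pi_1^{sc}(X,A,* )$$ is exact.
   Context: Semi-coarse spaces. A semi-coarse structure on a set $X$ is a collection $\mathcal{V}$ of subsets of $X\times X$ containing the diagonal $\Delta_X$ and closed under subsets, finite unions and inverses $V\mapsto V^{-1}=\{(y,x):(x,y)\in V\}$; $(X,\mathcal{V})$ is a semi-coarse space. A map $f:(X,\mathcal{V})\to(Y,\mathcal{W})$ is bornologous if $(f\times f)(V)\in\mathcal{W}$ for all $V\in\mathcal{V}$. A subset $Y\subset X$ carries the subspace structure $\{V\cap(Y\times Y):V\in\mathcal{V}\}$. The product structure $\mathcal{V}\times\mathcal{W}$ on $X\times Y$ consists of all subsets of finite unions of sets $V\boxtimes W=\{((a,b),(c,d)):(a,c)\in V,(b,d)\in W\}$ with $V\in\mathcal{V}$, $W\in\mathcal{W}$. $\mathbb{Z}$ carries the structure $\mathcal{Z}$ of all subsets of $\{(a,b)\in\mathbb{Z}^2:|a-b|\leq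 1\}$. For an integer $m\ge1$, $I_m=\{0,1,\dots,m\}$ has the subspace structure and $I_m^n$ the $n$-fold product structure (i.e. all sets of pairs $(x,y)$ with $|x_i-y_i|\le 1$ for all $i$). Put $\partial I_m^n=\{x\in I_m^n:\exists i,\ x_i\in\{0,m\}\}$ and $J_m^{n-1}=\{x\in\partial I_m^n:\text{ if }x_n=0\text{ then }\exists i\neq n\text{ with }x_i\in\{0,m\}\}$. For $B\subset A\subset X$, $D\subset C\subset Y$, a bornologous map of triples $f:(X,A,B)\to(Y,C,D)$ is a bornologous map $X\to Y$ with $f(A)\subset C$, $f(B)\subset D$. Two such maps $f,g$ are homotopic if there are a bornologous $H:(X\times\mathbb{Z},\mathcal{V}\times\mathcal{Z})\to(Y,\mathcal{W})$ and integers $M<N$ with $H(x,k)=f(x)$ for $k\le M$, $H(x,k)=g(x)$ for $k\ge N$, $H(A\times\mathbb{Z})\subset C$ and $H(B\times\mathbb{Z})\subset D$. For $m<m'$ let $\phi_m^{m'}:I_{m'}^n\to I_m^n$ replace each coordinate $x_k$ by $\min(x_k,m)$. Precomposition with $\phi_m^{m'}$ makes the sets $[(I_m^n,\partial I_m^n,J_m^{n-1}),(X,A,* )]$ of homotopy classes of bornologous maps of triples (writing $*$ for $\{*\}$) a directed system; for $n\ge1$, $\pi_n^{sc}(X,A,* )$ is its direct limit, $\langle f\rangle$ the class of $f$, and $\pi_n^{sc}(X,* )=\pi_n^{sc}(X,\{*\},* )$. In $\pi_n^{sc}(A,* )$, $A$ has the subspace structure. Group structure ($n\ge1$ for $\pi_n^{sc}(X,*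 )$, $n\geq 2$ for $\pi_n^{sc}(X,A,* )$): $\langle f\rangle\star\langle g\rangle=\langle f\star g\rangle$, where for $f$ on $I_m^n$, $g$ on $I_{m'}^n$, $f\star g$ on $I_{m+m'}^n$ is $f(\phi_m^{m+m'}(\alpha))$ if $0\le\alpha_1\le m$ and $g(\phi_{m'}^{m+m'}(\alpha-me_1))$ if $m<\alpha_1\le m+m'$, with $e_1=(1,0,\dots,0)$. The set $\pi_1^{sc}(X,A,* )$ is only a pointed set, with distinguished element the class of the constant map at $*$; exactness means that image equals kernel (preimage of the identity/distinguished element). Induced maps: a bornologous map of triples $f:(X,A,* )\to(Y,B,* )$ induces $f_*\langle h\rangle=\langle f\circ h\rangle$. Here $i_*$ is induced by $A\hookrightarrow X$, and $j_*$ by the identity of $X$ viewed as a map of triples $(X,\{*\},* )\to(X,A,* )$. *)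

theory Defs
  imports "HOL-Algebra.Coset" "HOL-Library.FuncSet"
begin

section \<open>Semi-coarse spaces\<close>

definition semi_coarse_space :: "'a set \<Rightarrow> ('a \<times> 'a) set set \<Rightarrow> bool" where
  "semi_coarse_space X V \<longleftrightarrow>
     V \<subseteq> Pow (X \<times> X) \<and> Id_on X \<in> V \<and>
     (\<forall>v\<in>V. \<forall>w. w \<subseteq> v \<longrightarrow> w \<in> V) \<and>
     (\<forall>v\<in>V. \<forall>w\<in>V. v \<union> w \<in> V) \<and>
     (\<forall>v\<in>V. v\<inverse> \<in> V)"

text \<open>
  Maps between carrier sets are total HOL functions of which only the values on the
  carrier matter; homotopy below identifies functions that agree on the carrier.
\<close>

definition bornologous ::
  "'a set \<Rightarrow> ('a \<times> 'a) set set \<Rightarrow> 'b set \<Rightarrow> ('b \<times> 'b) set set \<Rightarrow> ('a \<Rightarrow> 'b) \<Rightarrow> bool" where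
  "bornologous X V Y W f \<longleftrightarrow> f \<in> X \<rightarrow> Y \<and> (\<forall>v\<in>V. map_prod f f ` v \<in> W)"

definition sc_subspace :: "('a \<times> 'a) set set \<Rightarrow> 'a set \<Rightarrow> ('a \<times> 'a) set set" where
  "sc_subspace V Y = {v \<inter> (Y \<times> Y) | v. v \<in> V}"

definition sc_box :: "('a \<times> 'a) set \<Rightarrow> ('b \<times> 'b) set \<Rightarrow> (('a \<times> 'b) \<times> ('a \<times> 'b)) set" where
  "sc_box v w = {((a, b), (c, d)) | a b c d. (a, c) \<in> v \<and> (b, d) \<in> w}"

definition sc_prod ::
  "('a \<times> 'a) set set \<Rightarrow> ('b \<times> 'b) set set \<Rightarrow> (('a \<times> 'b) \<times> ('a \<times> 'b)) set set" where
  "sc_prod V W =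
     {E. \<exists>\<F>. finite \<F> \<and> \<F> \<subseteq> V \<times> W \<and> E \<subseteq> (\<Union>(v, w)\<in>\<F>. sc_box v w)}"

definition int_sc :: "(int \<times> int) set set" where
  "int_sc = Pow {(a, b). \<bar>a - b\<bar> \<le> 1}"


section \<open>Triples and homotopy\<close>

record 'a sc_triple =
  pts :: "'a set"
  ctrl :: "('a \<times> 'a) set set"
  sub1 :: "'a set"
  sub2 :: "'a set"

definition triple_map :: "'a sc_triple \<Rightarrow> 'b sc_triple \<Rightarrow> ('a \<Rightarrow> 'b) \<Rightarrow> bool" where
  "triple_map S T f \<longleftrightarrow>
     bornologous (pts S) (ctrl S) (pts T) (ctrl T) f \<and>
     f ` sub1 S \<subseteq> sub1 T \<and> f ` sub2 S \<subseteq> sub2 T"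

definition triple_homotopic ::
  "'a sc_triple \<Rightarrow> 'b sc_triple \<Rightarrow> ('a \<Rightarrow> 'b) \<Rightarrow> ('a \<Rightarrow> 'b) \<Rightarrow> bool" where
  "triple_homotopic S T f g \<longleftrightarrow>
     triple_map S T f \<and> triple_map S T g \<and>
     (\<exists>(H :: 'a \<times> int \<Rightarrow> 'b) M N.
        bornologous (pts S \<times> UNIV) (sc_prod (ctrl S) int_sc) (pts T) (ctrl T) H \<and>
        M < N \<and>
        (\<forall>x\<in>pts S. \<forall>k\<le>M. H (x, k) = f x) \<and>
        (\<forall>x\<in>pts S. \<forall>k\<ge>N. H (x, k) = g x) \<and>
        H ` (sub1 S \<times> UNIV) \<subseteq> sub1 T \<and>
        H ` (sub2 S \<times> UNIV) \<subseteq> sub2 T)"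

definition htpy_class :: "'a sc_triple \<Rightarrow> 'b sc_triple \<Rightarrow> ('a \<Rightarrow> 'b) \<Rightarrow> ('a \<Rightarrow> 'b) set" where
  "htpy_class S T f = {g. triple_homotopic S T f g}"

definition htpy_classes :: "'a sc_triple \<Rightarrow> 'b sc_triple \<Rightarrow> ('a \<Rightarrow> 'b) set set" where
  "htpy_classes S T = htpy_class S T ` {f. triple_map S T f}"


section \<open>Cubes\<close>

text \<open>
  Points of the \<open>n\<close>-cube are integer-valued functions on \<open>{1..n}\<close>, extensional so that
  equality of points is equality of coordinates.
\<close>

definition cube :: "nat \<Rightarrow> nat \<Rightarrow> (nat \<Rightarrow> int) set" where
  "cube n m = {1..n} \<rightarrow>\<^sub>E {0..int m}"

definition cube_sc :: "nat \<Rightarrow> nat \<Rightarrow> ((nat \<Rightarrow> int) \<times> (nat \<Rightarrow> int)) set set" where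
  "cube_sc n m =
     Pow {(x, y). x \<in> cube n m \<and> y \<in> cube n m \<and> (\<forall>i\<in>{1..n}. \<bar>x i - y i\<bar> \<le> 1)}"

definition cube_bd :: "nat \<Rightarrow> nat \<Rightarrow> (nat \<Rightarrow> int) set" where
  "cube_bd n m = {x \<in> cube n m. \<exists>i\<in>{1..n}. x i \<in> {0, int m}}"

text \<open>The union of all faces of the cube other than the one given by \<open>x n = 0\<close>.\<close>

definition cube_J :: "nat \<Rightarrow> nat \<Rightarrow> (nat \<Rightarrow> int) set" where
  "cube_J n m =
     {x \<in> cube_bd n m. x n = 0 \<longrightarrow> (\<exists>i\<in>{1..n}. i \<noteq> n \<and> x i \<in> {0, int m})}"

definition cube_triple :: "nat \<Rightarrow> nat \<Rightarrow> (nat \<Rightarrow> int) sc_triple" where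
  "cube_triple n m =
     \<lparr>pts = cube n m, ctrl = cube_sc n m, sub1 = cube_bd n m, sub2 = cube_J n m\<rparr>"

text \<open>
  The structure \<open>cube_sc\<close> is the iterated product of the subspace structure
  of the interval \<open>{0..m}\<close>.
\<close>

lemma sc_prod_Pow: "sc_prod (Pow E) (Pow F) = Pow (sc_box E F)"
proof (intro subset_antisym subsetI PowI)
  fix G e assume "G \<in> sc_prod (Pow E) (Pow F)" and "e \<in> G"
  then obtain \<F> where "\<F> \<subseteq> Pow E \<times> Pow F" and "e \<in> (\<Union>(v, w)\<in>\<F>. sc_box v w)"
    unfolding sc_prod_def mem_Collect_eq by (elim exE conjE) (drule (1) subsetD)
  then obtain v w where "v \<subseteq> E" "w \<subseteq> F" "e \<in> sc_box v w"
    by auto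
  moreover have "sc_box v w \<subseteq> sc_box E F" if "v \<subseteq> E" "w \<subseteq> F" for v w
    using that unfolding sc_box_def by blast
  ultimately show "e \<in> sc_box E F" by blast
next
  fix G assume "G \<in> Pow (sc_box E F)"
  then have "finite {(E, F)} \<and> {(E, F)} \<subseteq> Pow E \<times> Pow F \<and> G \<subseteq> (\<Union>(v, w)\<in>{(E, F)}. sc_box v w)"
    by simp
  then show "G \<in> sc_prod (Pow E) (Pow F)"
    unfolding sc_prod_def by (intro CollectI exI)
qed

lemma sc_subspace_interval:
  "sc_subspace int_sc {0..int m} =
     Pow {(a, b). a \<in> {0..int m} \<and> b \<in> {0..int m} \<and> \<bar>a - b\<bar> \<le> 1}"
proof -
  have "sc_subspace (Pow E) Y = Pow (E \<inter> Y \<times> Y)" for E :: "(int \<times> int) set" and Y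
    unfolding sc_subspace_def by blast
  moreover have "{(a, b). \<bar>a - b\<bar> \<le> 1} \<inter> {0..int m} \<times> {0..int m} =
      {(a, b). a \<in> {0..int m} \<and> b \<in> {0..int m} \<and> \<bar>a - b\<bar> \<le> 1}"
    by fast
  ultimately show ?thesis
    unfolding int_sc_def by (simp only:)
qed

lemma cube_sc_Suc:
  assumes "E \<subseteq> (cube n m \<times> {0..int m}) \<times> (cube n m \<times> {0..int m})"
  defines "h \<equiv> \<lambda>(x :: nat \<Rightarrow> int, t). x(Suc n := t)"
  shows "bij_betw h (cube n m \<times> {0..int m}) (cube (Suc n) m)"
    and "map_prod h h ` E \<in> cube_sc (Suc n) m \<longleftrightarrow>
         E \<in> sc_prod (cube_sc n m) (sc_subspace int_sc {0..int m})"
proof -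
  have ins: "{1..Suc n} = insert (Suc n) {1..n}" by auto
  show b: "bij_betw h (cube n m \<times> {0..int m}) (cube (Suc n) m)"
  proof (rule bij_betwI[where g = "\<lambda>y. (y(Suc n := undefined), y (Suc n))"])
    show "h \<in> cube n m \<times> {0..int m} \<rightarrow> cube (Suc n) m"
      unfolding h_def cube_def ins by (auto simp: PiE_def Pi_def extensional_def)
    show "(\<lambda>y. (y(Suc n := undefined), y (Suc n))) \<in> cube (Suc n) m \<rightarrow> cube n m \<times> {0..int m}"
      unfolding cube_def ins by (auto simp: PiE_def Pi_def extensional_def)
  next
    fix z assume "z \<in> cube n m \<times> {0..int m}"
    then show "((h z)(Suc n := undefined), h z (Suc n)) = z"
      unfolding h_def cube_def
      by (auto simp: PiE_def extensional_def fun_eq_iff split: prod.splits)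
  next
    fix y
    show "h (y(Suc n := undefined), y (Suc n)) = y"
      unfolding h_def by simp
  qed
  have key: "(\<forall>i\<in>{1..Suc n}. \<bar>h (x, s) i - h (y, t) i\<bar> \<le> 1) \<longleftrightarrow>
      (\<forall>i\<in>{1..n}. \<bar>x i - y i\<bar> \<le> 1) \<and> \<bar>s - t\<bar> \<le> 1" for x y s t
    unfolding ins h_def by auto
  have mem: "h z \<in> cube (Suc n) m" if "z \<in> cube n m \<times> {0..int m}" for z
    using b that by (auto simp: bij_betw_def)
  define R where "R = {(x, y). x \<in> cube n m \<and> y \<in> cube n m \<and> (\<forall>i\<in>{1..n}. \<bar>x i - y i\<bar> \<le> 1)}"
  define S where "S = {(a, b). a \<in> {0..int m} \<and> b \<in> {0..int m} \<and> \<bar>a - b\<bar> \<le> 1}"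
  define Q where "Q = {(x, y). x \<in> cube (Suc n) m \<and> y \<in> cube (Suc n) m \<and>
    (\<forall>i\<in>{1..Suc n}. \<bar>x i - y i\<bar> \<le> 1)}"
  have *: "(h (x, s), h (y, t)) \<in> Q \<longleftrightarrow> ((x, s), (y, t)) \<in> sc_box R S"
    if "((x, s), (y, t)) \<in> E" for x s y t
  proof -
    have z: "(x, s) \<in> cube n m \<times> {0..int m}" "(y, t) \<in> cube n m \<times> {0..int m}"
      using that assms(1) by blast+
    have "(h (x, s), h (y, t)) \<in> Q \<longleftrightarrow>
        (\<forall>i\<in>{1..n}. \<bar>x i - y i\<bar> \<le> 1) \<and> \<bar>s - t\<bar> \<le> 1"
      unfolding Q_def mem_Collect_eq prod.case key using mem[OF z(1)] mem[OF z(2)] by blast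
    moreover have "((x, s), (y, t)) \<in> sc_box R S \<longleftrightarrow> (x, y) \<in> R \<and> (s, t) \<in> S"
      unfolding sc_box_def by blast
    ultimately show ?thesis
      using z unfolding R_def S_def by simp
  qed
  have "map_prod h h ` E \<subseteq> Q \<longleftrightarrow> E \<subseteq> sc_box R S"
  proof -
    have "map_prod h h e \<in> Q \<longleftrightarrow> e \<in> sc_box R S" if "e \<in> E" for e
      using that *[of "fst (fst e)" "snd (fst e)" "fst (snd e)" "snd (snd e)"]
      by (simp add: map_prod_def case_prod_beta)
    then show ?thesis
      unfolding image_subset_iff by blast
  qed
  then show "map_prod h h ` E \<in> cube_sc (Suc n) m \<longleftrightarrow>
         E \<in> sc_prod (cube_sc n m) (sc_subspace int_sc {0..int m})"
    unfolding sc_subspace_interval cube_sc_def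
    by (simp only: R_def[symmetric] S_def[symmetric] Q_def[symmetric] sc_prod_Pow Pow_iff)
qed

text \<open>The map \<open>collapse n m\<close> is defined at once on all larger cubes.\<close>

definition collapse :: "nat \<Rightarrow> nat \<Rightarrow> (nat \<Rightarrow> int) \<Rightarrow> (nat \<Rightarrow> int)" where
  "collapse n m x = (\<lambda>k\<in>{1..n}. min (x k) (int m))"


section \<open>Direct limits\<close>

text \<open>
  Direct limit, over the positive naturals, of the sets \<open>D m\<close> with transition maps
  \<open>t m m' : D m \<rightarrow> D m'\<close> for \<open>m \<le> m'\<close>.
\<close>

definition dlim_rel ::
  "(nat \<Rightarrow> 'c set) \<Rightarrow> (nat \<Rightarrow> nat \<Rightarrow> 'c \<Rightarrow> 'c) \<Rightarrow> ((nat \<times> 'c) \<times> (nat \<times> 'c)) set" where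
  "dlim_rel D t =
     {((m, c), (m', c')). (m, c) \<in> Sigma {1..} D \<and> (m', c') \<in> Sigma {1..} D \<and>
        (\<exists>k. m \<le> k \<and> m' \<le> k \<and> t m k c = t m' k c')}"

definition dlim :: "(nat \<Rightarrow> 'c set) \<Rightarrow> (nat \<Rightarrow> nat \<Rightarrow> 'c \<Rightarrow> 'c) \<Rightarrow> (nat \<times> 'c) set set" where
  "dlim D t = Sigma {1..} D // dlim_rel D t"


section \<open>Semi-coarse homotopy groups\<close>

text \<open>
  Below, \<open>T\<close> is a triple of the form \<open>(X, A, {p})\<close>. Operations on classes are given on
  representatives; the description operator demands independence of the choice.
\<close>

definition precomp ::
  "'a sc_triple \<Rightarrow> nat \<Rightarrow> nat \<Rightarrow> nat \<Rightarrow> ((nat \<Rightarrow> int) \<Rightarrow> 'a) set \<Rightarrow> ((nat \<Rightarrow> int) \<Rightarrow> 'a) set" where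
  "precomp T n m m' c =
     (THE d. \<exists>f. triple_map (cube_triple n m) T f \<and>
        c = htpy_class (cube_triple n m) T f \<and>
        d = htpy_class (cube_triple n m') T (f \<circ> collapse n m))"

abbreviation cube_classes :: "'a sc_triple \<Rightarrow> nat \<Rightarrow> nat \<Rightarrow> ((nat \<Rightarrow> int) \<Rightarrow> 'a) set set" where
  "cube_classes T n m \<equiv> htpy_classes (cube_triple n m) T"

definition pi_class ::
  "'a sc_triple \<Rightarrow> nat \<Rightarrow> nat \<Rightarrow> ((nat \<Rightarrow> int) \<Rightarrow> 'a) \<Rightarrow> (nat \<times> ((nat \<Rightarrow> int) \<Rightarrow> 'a) set) set" where
  "pi_class T n m f =
     dlim_rel (cube_classes T n) (precomp T n) `` {(m, htpy_class (cube_triple n m) T f)}"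

definition cube_concat ::
  "nat \<Rightarrow> nat \<Rightarrow> nat \<Rightarrow> ((nat \<Rightarrow> int) \<Rightarrow> 'a) \<Rightarrow> ((nat \<Rightarrow> int) \<Rightarrow> 'a) \<Rightarrow> ((nat \<Rightarrow> int) \<Rightarrow> 'a)" where
  "cube_concat n m m' f g = (\<lambda>\<alpha>.
     if \<alpha> 1 \<le> int m then f (collapse n m \<alpha>)
     else g (collapse n m' (\<alpha>(1 := \<alpha> 1 - int m))))"

text \<open>
  For \<open>n = 1\<close> and a proper pair, only the carrier and the distinguished element \<open>one\<close>
  are meaningful.
\<close>

definition pi_sc :: "nat \<Rightarrow> 'a sc_triple \<Rightarrow> (nat \<times> ((nat \<Rightarrow> int) \<Rightarrow> 'a) set) set monoid" where
  "pi_sc n T =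
     \<lparr>carrier = dlim (cube_classes T n) (precomp T n),
      mult = (\<lambda>a b. THE c. \<exists>m\<ge>1. \<exists>m'\<ge>1. \<exists>f g.
        triple_map (cube_triple n m) T f \<and> triple_map (cube_triple n m') T g \<and>
        a = pi_class T n m f \<and> b = pi_class T n m' g \<and>
        c = pi_class T n (m + m') (cube_concat n m m' f g)),
      one = pi_class T n 1 (\<lambda>_. the_elem (sub2 T))\<rparr>"

definition pi_induced ::
  "nat \<Rightarrow> 'a sc_triple \<Rightarrow> 'b sc_triple \<Rightarrow> ('a \<Rightarrow> 'b) \<Rightarrow>
   (nat \<times> ((nat \<Rightarrow> int) \<Rightarrow> 'a) set) set \<Rightarrow> (nat \<times> ((nat \<Rightarrow> int) \<Rightarrow> 'b) set) set" where
  "pi_induced n S T F a =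
     (THE c. \<exists>m\<ge>1. \<exists>h. triple_map (cube_triple n m) S h \<and>
        a = pi_class S n m h \<and> c = pi_class T n m (F \<circ> h))"

definition rel_space :: "'a set \<Rightarrow> ('a \<times> 'a) set set \<Rightarrow> 'a set \<Rightarrow> 'a \<Rightarrow> 'a sc_triple" where
  "rel_space X V A p = \<lparr>pts = X, ctrl = V, sub1 = A, sub2 = {p}\<rparr>"

definition abs_space :: "'a set \<Rightarrow> ('a \<times> 'a) set set \<Rightarrow> 'a \<Rightarrow> 'a sc_triple" where
  "abs_space X V p = rel_space X V {p} p"

end

theory Submission
  imports Defs
begin

text \<open>
  The boundary map restricts a map of cubes to the face \<open>x\<^sub>n = 0\<close>. Exactness follows the
  classical proof, except that the usual homotopies cannot be used: a homotopy has to be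
  nonexpansive in space and time jointly for the sup metric, and already \<open>f (s + t)\<close>
  may move by two steps. Every homotopy here reparametrises a given map by minima and
  maxima of coordinates and time, which are nonexpansive; the direct limit provides the room
  in which these reparametrisations take place.
\<close>

section \<open>Adjacency on cubes\<close>

text \<open>The product structure controls steps taken in space and time together, so time is on the
  same footing as one more coordinate. A contraction of a map on a cube can therefore be reread as a
  map on a cube of one dimension more, provided the side of that cube is at least the duration of
  the contraction. All three inclusions of a kernel in an image rest on this: time becomes the last
  coordinate, is exchanged with it, or prolongs it below zero. A class is trivial when some
  representative contracts after being collapsed from a larger side, so exactness is argued on
  representatives. The operations are given by definite descriptions and each has to be shown
  independent of the choice of representative. For induced maps and the boundary this is
  functoriality of homotopies. For the product it is the main geometric difficulty: enlarging the
  cube of the first factor inserts a waiting period before the second one, and sliding the second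
  factor across it at unit speed would move space and time at once.\<close>

definition cadj :: "nat \<Rightarrow> nat \<Rightarrow> (nat \<Rightarrow> int) \<Rightarrow> (nat \<Rightarrow> int) \<Rightarrow> bool" where
  "cadj n m x y \<longleftrightarrow> x \<in> cube n m \<and> y \<in> cube n m \<and> (\<forall>i\<in>{1..n}. \<bar>x i - y i\<bar> \<le> 1)"

lemma cadj_refl: "x \<in> cube n m \<Longrightarrow> cadj n m x x"
  by (simp add: cadj_def)

lemma cadjD:
  assumes "cadj n m x y"
  shows "x \<in> cube n m" "y \<in> cube n m" "i \<in> {1..n} \<Longrightarrow> \<bar>x i - y i\<bar> \<le> 1"
  using assms by (auto simp: cadj_def)

lemma cube_sc_cadj: "cube_sc n m = Pow {(x, y). cadj n m x y}"
  by (simp add: cube_sc_def cadj_def)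

lemma cube_coord:
  assumes "x \<in> cube n m" "i \<in> {1..n}"
  shows "0 \<le> x i" "x i \<le> int m"
  using assms by (auto simp: cube_def PiE_def Pi_def)

lemma cube_update:
  assumes "x \<in> cube n m" "l \<in> {1..n}" "0 \<le> s" "s \<le> int m"
  shows "x(l := s) \<in> cube n m"
  using assms by (auto simp: cube_def PiE_def Pi_def extensional_def)

lemma cadj_update:
  assumes "cadj n m x y" "l \<in> {1..n}" "0 \<le> s" "s \<le> int m" "0 \<le> t" "t \<le> int m" "\<bar>s - t\<bar> \<le> 1"
  shows "cadj n m (x(l := s)) (y(l := t))"
  using assms by (auto simp: cadj_def cube_update)

lemma cube_extend:
  assumes "y \<in> cube n m" "0 \<le> s" "s \<le> int m"
  shows "y(Suc n := s) \<in> cube (Suc n) m"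
  using assms by (auto simp: cube_def PiE_def Pi_def extensional_def le_Suc_eq)

lemma cadj_extend:
  assumes "cadj n m x y" "0 \<le> s" "s \<le> int m" "0 \<le> t" "t \<le> int m" "\<bar>s - t\<bar> \<le> 1"
  shows "cadj (Suc n) m (x(Suc n := s)) (y(Suc n := t))"
  using assms by (auto simp: cadj_def cube_extend le_Suc_eq)

lemma collapse_apply: "i \<in> {1..n} \<Longrightarrow> collapse n m x i = min (x i) (int m)"
  by (simp add: collapse_def)

lemma collapse_in_cube:
  assumes "\<And>i. i \<in> {1..n} \<Longrightarrow> 0 \<le> x i"
  shows "collapse n m x \<in> cube n m"
  using assms by (auto simp: collapse_def cube_def)

lemma collapse_cube: "x \<in> cube n k \<Longrightarrow> collapse n m x \<in> cube n m"
  by (rule collapse_in_cube) (auto dest: cube_coord)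

text \<open>As \<open>collapse n\<close> restricts to \<open>{1..n}\<close>, on a cube of dimension
  \<open>Suc n\<close> it also forgets the last coordinate. This splits a point into a space part
  and a coordinate free to serve as time.\<close>

lemma collapse_cube_Suc:
  assumes "x \<in> cube (Suc n) k"
  shows "collapse n m x \<in> cube n m"
  by (rule collapse_in_cube) (use cube_coord(1)[OF assms] in auto)

lemma collapse_collapse: "m \<le> k \<Longrightarrow> collapse n m (collapse n k x) = collapse n m x"
  by (auto simp: collapse_def restrict_def fun_eq_iff)

lemma collapse_extend:
  "0 \<le> s \<Longrightarrow> collapse (Suc n) m (x(Suc n := s)) = (collapse n m x)(Suc n := min s (int m))"
  by (auto simp: collapse_def restrict_def fun_eq_iff)

lemma collapse_ignore: "collapse n m (x(Suc n := s)) = collapse n m x"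
  by (auto simp: collapse_def restrict_def fun_eq_iff)

lemma cadj_collapse: "cadj n k x y \<Longrightarrow> cadj n m (collapse n m x) (collapse n m y)"
  unfolding cadj_def by (auto simp: collapse_cube collapse_apply min_def)

lemma cadj_collapse_Suc:
  assumes "cadj (Suc n) k x y"
  shows "cadj n m (collapse n m x) (collapse n m y)"
proof -
  have "\<bar>min (x i) (int m) - min (y i) (int m)\<bar> \<le> 1" if "i \<in> {1..n}" for i
    using cadjD(3)[OF assms, of i] that by auto
  then show ?thesis
    using cadjD(1,2)[OF assms] by (simp add: cadj_def collapse_cube_Suc collapse_apply)
qed

section \<open>Faces of the cube under extension and collapse\<close>

lemma bd_cube: "x \<in> cube_bd n m \<Longrightarrow> x \<in> cube n m"
  by (simp add: cube_bd_def)

lemma J_bd: "x \<in> cube_J n m \<Longrightarrow> x \<in> cube_bd n m"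
  by (simp add: cube_J_def)

lemma J_cube: "x \<in> cube_J n m \<Longrightarrow> x \<in> cube n m"
  by (simp add: cube_J_def cube_bd_def)

lemma collapse_face:
  assumes "m \<le> k" "i \<in> {1..n}" "x i \<in> {0, int k}"
  shows "collapse n m x i \<in> {0, int m}"
  using assms by (auto simp: collapse_apply)

lemma collapse_bd:
  assumes "m \<le> k" "x \<in> cube_bd n k"
  shows "collapse n m x \<in> cube_bd n m"
  using assms collapse_face[OF assms(1)] by (fastforce simp: cube_bd_def collapse_cube)

lemma mem_bd_Suc:
  "x \<in> cube_bd (Suc n) m \<longleftrightarrow>
     x \<in> cube (Suc n) m \<and> (x (Suc n) \<in> {0, int m} \<or> (\<exists>i\<in>{1..n}. x i \<in> {0, int m}))"
  by (simp add: cube_bd_def atLeastAtMostSuc_conv)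

text \<open>For positive \<open>m\<close> the ends \<open>0\<close> and \<open>m\<close> differ,
  which turns the implication in \<open>cube_J\<close> into a list of faces. For
  \<open>m = 0\<close> the omitted face would coincide with the opposite one.\<close>

lemma mem_J_Suc:
  assumes "1 \<le> m"
  shows "x \<in> cube_J (Suc n) m \<longleftrightarrow>
     x \<in> cube (Suc n) m \<and> (x (Suc n) = int m \<or> (\<exists>i\<in>{1..n}. x i \<in> {0, int m}))"
proof -
  have "(\<exists>i\<in>{1..Suc n}. i \<noteq> Suc n \<and> x i \<in> {0, int m}) \<longleftrightarrow> (\<exists>i\<in>{1..n}. x i \<in> {0, int m})"
    by (force simp: atLeastAtMostSuc_conv)
  then show ?thesis
    using assms unfolding cube_J_def mem_Collect_eq mem_bd_Suc by auto
qed

lemma collapse_J: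
  assumes "1 \<le> m" "m \<le> k" "x \<in> cube_J (Suc n) k"
  shows "collapse (Suc n) m x \<in> cube_J (Suc n) m"
proof -
  have "1 \<le> k" using assms by simp
  then consider "x (Suc n) = int k" | i where "i \<in> {1..n}" "x i \<in> {0, int k}"
    using assms(3) by (auto simp: mem_J_Suc)
  then show ?thesis
  proof cases
    case 1
    then show ?thesis
      using assms collapse_cube[OF J_cube[OF assms(3)]] by (simp add: mem_J_Suc collapse_apply)
  next
    case 2
    then have "collapse (Suc n) m x i \<in> {0, int m}"
      using assms by (intro collapse_face[of m k]) auto
    then show ?thesis
      using assms(1) 2 collapse_cube[OF J_cube[OF assms(3)]] by (auto simp: mem_J_Suc)
  qed
qed

section \<open>Maps and homotopies of cubes\<close>

text \<open>
  Membership of the values in the carrier is not recorded, as controlled sets lie in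
  its square.
\<close>

definition cube_htpy ::
  "('a \<times> 'a) set set \<Rightarrow> 'a set \<Rightarrow> 'a \<Rightarrow> nat \<Rightarrow> nat \<Rightarrow> ((nat \<Rightarrow> int) \<Rightarrow> int \<Rightarrow> 'a) \<Rightarrow> bool" where
  "cube_htpy V A p n m H \<longleftrightarrow>
     (\<exists>v\<in>V. \<forall>x y k l. cadj n m x y \<longrightarrow> \<bar>k - l\<bar> \<le> 1 \<longrightarrow> (H x k, H y l) \<in> v) \<and>
     (\<forall>x\<in>cube_bd n m. \<forall>k. H x k \<in> A) \<and> (\<forall>x\<in>cube_J n m. \<forall>k. H x k = p)"

text \<open>A map is a homotopy that ignores time, so each construction on homotopies below
  specialises to maps.\<close>

abbreviation cube_map ::
  "('a \<times> 'a) set set \<Rightarrow> 'a set \<Rightarrow> 'a \<Rightarrow> nat \<Rightarrow> nat \<Rightarrow> ((nat \<Rightarrow> int) \<Rightarrow> 'a) \<Rightarrow> bool" where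
  "cube_map V A p n m f \<equiv> cube_htpy V A p n m (\<lambda>x _. f x)"

text \<open>The start is normalised to time \<open>0\<close>, while the end \<open>N\<close> may be
  any integer; \<open>htpicI\<close> shifts arbitrary time bounds into this form.\<close>

definition htpic ::
  "('a \<times> 'a) set set \<Rightarrow> 'a set \<Rightarrow> 'a \<Rightarrow> nat \<Rightarrow> nat \<Rightarrow>
   ((nat \<Rightarrow> int) \<Rightarrow> 'a) \<Rightarrow> ((nat \<Rightarrow> int) \<Rightarrow> 'a) \<Rightarrow> bool" where
  "htpic V A p n m f g \<longleftrightarrow>
     (\<exists>H N. cube_htpy V A p n m H \<and> (\<forall>x\<in>cube n m. \<forall>k\<le>0. H x k = f x) \<and>
        (\<forall>x\<in>cube n m. \<forall>k\<ge>N. H x k = g x))"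

lemma cube_htpyI:
  assumes "v \<in> V"
    and "\<And>x y k l. cadj n m x y \<Longrightarrow> \<bar>k - l\<bar> \<le> 1 \<Longrightarrow> (H x k, H y l) \<in> v"
    and "\<And>x k. x \<in> cube_bd n m \<Longrightarrow> H x k \<in> A"
    and "\<And>x k. x \<in> cube_J n m \<Longrightarrow> H x k = p"
  shows "cube_htpy V A p n m H"
  using assms unfolding cube_htpy_def by blast

lemma cube_htpyE:
  assumes "cube_htpy V A p n m H"
  obtains v where "v \<in> V" "\<And>x y k l. cadj n m x y \<Longrightarrow> \<bar>k - l\<bar> \<le> 1 \<Longrightarrow> (H x k, H y l) \<in> v"
  using assms unfolding cube_htpy_def by blast

lemma cube_htpy_bd: "cube_htpy V A p n m H \<Longrightarrow> x \<in> cube_bd n m \<Longrightarrow> H x k \<in> A"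
  by (simp add: cube_htpy_def)

lemma cube_htpy_J: "cube_htpy V A p n m H \<Longrightarrow> x \<in> cube_J n m \<Longrightarrow> H x k = p"
  by (simp add: cube_htpy_def)

lemma cube_htpy_cong:
  assumes "cube_htpy V A p n m H" "\<And>x k. x \<in> cube n m \<Longrightarrow> H x k = H' x k"
  shows "cube_htpy V A p n m H'"
proof -
  obtain v where v: "v \<in> V" "\<And>x y k l. cadj n m x y \<Longrightarrow> \<bar>k - l\<bar> \<le> 1 \<Longrightarrow> (H x k, H y l) \<in> v"
    using assms(1) by (rule cube_htpyE) blast
  show ?thesis
  proof (rule cube_htpyI[OF v(1)])
    show "(H' x k, H' y l) \<in> v" if "cadj n m x y" "\<bar>k - l\<bar> \<le> 1" for x y k l
      using v(2)[OF that] cadjD(1,2)[OF that(1)] assms(2) by simp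
  qed (use cube_htpy_bd[OF assms(1)] cube_htpy_J[OF assms(1)] assms(2) bd_cube J_cube in \<open>metis+\<close>)
qed

lemma cube_htpy_time:
  assumes "cube_htpy V A p n m H" "\<And>k l. \<bar>k - l\<bar> \<le> 1 \<Longrightarrow> \<bar>r k - r l\<bar> \<le> 1"
  shows "cube_htpy V A p n m (\<lambda>x k. H x (r k))"
  using assms unfolding cube_htpy_def by meson

lemma cube_htpy_slice: "cube_htpy V A p n m H \<Longrightarrow> cube_map V A p n m (\<lambda>x. H x k)"
  by (rule cube_htpy_time) auto

lemma cube_map_cong:
  assumes "cube_map V A p n m f" "\<And>x. x \<in> cube n m \<Longrightarrow> f x = g x"
  shows "cube_map V A p n m g"
  using assms by (rule cube_htpy_cong)

lemma htpicI:
  assumes "cube_htpy V A p n m H" "\<And>x k. x \<in> cube n m \<Longrightarrow> k \<le> M \<Longrightarrow> H x k = f x"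
    "\<And>x k. x \<in> cube n m \<Longrightarrow> N \<le> k \<Longrightarrow> H x k = g x"
  shows "htpic V A p n m f g"
  unfolding htpic_def
proof (intro exI conjI ballI allI impI)
  show "cube_htpy V A p n m (\<lambda>x k. H x (k + M))"
    using assms(1) by (rule cube_htpy_time) auto
  show "H x (k + M) = f x" if "x \<in> cube n m" "k \<le> 0" for x k
    using assms(2) that by simp
  show "H x (k + M) = g x" if "x \<in> cube n m" "N - M \<le> k" for x k
    using assms(3) that by simp
qed

text \<open>A homotopy that has become stationary stays so, hence its end may be postponed beyond
  any prescribed \<open>b\<close>. Later, \<open>b\<close> is the side of a cube that the time range
  has to exceed.\<close>

lemma htpicE:
  assumes "htpic V A p n m f g"
  obtains H N where "cube_htpy V A p n m H" "\<And>x k. x \<in> cube n m \<Longrightarrow> k \<le> 0 \<Longrightarrow> H x k = f x"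
    "\<And>x k. x \<in> cube n m \<Longrightarrow> int N \<le> k \<Longrightarrow> H x k = g x" "b \<le> N"
proof -
  obtain H N where H: "cube_htpy V A p n m H" "\<forall>x\<in>cube n m. \<forall>k\<le>0. H x k = f x"
    "\<forall>x\<in>cube n m. \<forall>k\<ge>N. H x k = g x"
    using assms unfolding htpic_def by blast
  show ?thesis
    using H that[of H "max b (nat N)"] by (simp add: le_max_iff_disj)
qed

lemma htpic_map1:
  assumes "htpic V A p n m f g"
  shows "cube_map V A p n m f"
proof -
  obtain H N where H: "cube_htpy V A p n m H" "\<And>x k. x \<in> cube n m \<Longrightarrow> k \<le> 0 \<Longrightarrow> H x k = f x"
    using assms by (rule htpicE[where b = 0]) blast
  show ?thesis
    by (rule cube_map_cong[OF cube_htpy_slice[OF H(1), of 0]]) (simp add: H(2))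
qed

lemma htpic_map2:
  assumes "htpic V A p n m f g"
  shows "cube_map V A p n m g"
proof -
  obtain H N where H: "cube_htpy V A p n m H"
    "\<And>x k. x \<in> cube n m \<Longrightarrow> int N \<le> k \<Longrightarrow> H x k = g x"
    using assms by (rule htpicE[where b = 0]) blast
  show ?thesis
    by (rule cube_map_cong[OF cube_htpy_slice[OF H(1), of "int N"]]) (simp add: H(2))
qed

lemma htpic_eq:
  assumes "cube_map V A p n m f" "\<And>x. x \<in> cube n m \<Longrightarrow> f x = g x"
  shows "htpic V A p n m f g"
  by (rule htpicI[OF assms(1), where M = 0 and N = 0]) (auto simp: assms(2))

lemma htpic_sym:
  assumes "htpic V A p n m f g"
  shows "htpic V A p n m g f"
proof -
  obtain H N where H: "cube_htpy V A p n m H" "\<And>x k. x \<in> cube n m \<Longrightarrow> k \<le> 0 \<Longrightarrow> H x k = f x"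
    "\<And>x k. x \<in> cube n m \<Longrightarrow> int N \<le> k \<Longrightarrow> H x k = g x"
    using assms by (rule htpicE[where b = 0]) blast
  have "cube_htpy V A p n m (\<lambda>x k. H x (- k))"
    using H(1) by (rule cube_htpy_time) auto
  then show ?thesis
    by (rule htpicI[where M = "- int N" and N = 0]) (auto simp: H(2,3))
qed

lemma collapse_htpy:
  assumes H: "cube_htpy V A p (Suc n) m H" and "1 \<le> m" "m \<le> k"
  shows "cube_htpy V A p (Suc n) k (\<lambda>x. H (collapse (Suc n) m x))"
proof -
  obtain v where v: "v \<in> V" "\<And>x y k l. cadj (Suc n) m x y \<Longrightarrow> \<bar>k - l\<bar> \<le> 1 \<Longrightarrow> (H x k, H y l) \<in> v"
    using H by (rule cube_htpyE) blast
  show ?thesis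
    using assms
    by (intro cube_htpyI[OF v(1)] v(2) cadj_collapse cube_htpy_bd[OF H] cube_htpy_J[OF H]
        collapse_bd collapse_J)
qed

lemma htpic_collapse:
  assumes "htpic V A p (Suc n) m f g" "1 \<le> m" "m \<le> k"
  shows "htpic V A p (Suc n) k (f \<circ> collapse (Suc n) m) (g \<circ> collapse (Suc n) m)"
proof -
  obtain H N where H: "cube_htpy V A p (Suc n) m H"
    "\<And>x k. x \<in> cube (Suc n) m \<Longrightarrow> k \<le> 0 \<Longrightarrow> H x k = f x"
    "\<And>x k. x \<in> cube (Suc n) m \<Longrightarrow> int N \<le> k \<Longrightarrow> H x k = g x"
    using assms(1) by (rule htpicE[where b = 0]) blast
  show ?thesis
    by (rule htpicI[OF collapse_htpy[OF H(1) assms(2,3)], where M = 0 and N = "int N"])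
       (auto simp: H(2,3) collapse_cube)
qed

section \<open>Translation between triples and maps of cubes\<close>

locale pointed_pair =
  fixes X :: "'a set" and V :: "('a \<times> 'a) set set" and A :: "'a set" and p :: 'a
  assumes sc: "semi_coarse_space X V" and base: "p \<in> A" and sub: "A \<subseteq> X"
begin

abbreviation "T \<equiv> rel_space X V A p"

lemma controlled_subset: "v \<in> V \<Longrightarrow> w \<subseteq> v \<Longrightarrow> w \<in> V"
  using sc by (auto simp: semi_coarse_space_def)

lemma controlled_Un: "v \<in> V \<Longrightarrow> w \<in> V \<Longrightarrow> v \<union> w \<in> V"
  using sc by (auto simp: semi_coarse_space_def)

lemma controlled_carrier: "v \<in> V \<Longrightarrow> v \<subseteq> X \<times> X"
  using sc by (auto simp: semi_coarse_space_def)

lemma Id_controlled: "Id_on X \<in> V"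
  using sc by (auto simp: semi_coarse_space_def)

lemma htpy_carrier:
  assumes "cube_htpy V A p n m H" "x \<in> cube n m"
  shows "H x k \<in> X"
proof -
  obtain v where v: "v \<in> V" "\<And>x y k l. cadj n m x y \<Longrightarrow> \<bar>k - l\<bar> \<le> 1 \<Longrightarrow> (H x k, H y l) \<in> v"
    using assms(1) by (rule cube_htpyE) blast
  show ?thesis
    using v(2)[OF cadj_refl[OF assms(2)], of k k] controlled_carrier[OF v(1)] by auto
qed

text \<open>The structure of the cube is the powerset of the adjacency relation, so bornology is
  tested on that one set: its image is the single controlled set of \<open>cube_htpy\<close>, and
  closure under subsets gives the converse.\<close>

lemma triple_map_iff: "triple_map (cube_triple n m) T f \<longleftrightarrow> cube_map V A p n m f"
proof
  assume f: "triple_map (cube_triple n m) T f"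
  have "map_prod f f ` {(x, y). cadj n m x y} \<in> V"
    using f by (auto simp: triple_map_def bornologous_def cube_triple_def rel_space_def cube_sc_cadj)
  then show "cube_map V A p n m f"
    by (rule cube_htpyI)
       (use f in \<open>auto simp: triple_map_def cube_triple_def rel_space_def image_subset_iff\<close>)
next
  assume f: "cube_map V A p n m f"
  obtain v where v: "v \<in> V" "\<And>x y. cadj n m x y \<Longrightarrow> (f x, f y) \<in> v"
    using f by (rule cube_htpyE) (metis abs_zero diff_self zero_le_one)
  have "map_prod f f ` w \<in> V" if "w \<subseteq> {(x, y). cadj n m x y}" for w
    using v that by (intro controlled_subset[OF v(1)]) auto
  then show "triple_map (cube_triple n m) T f"
    using htpy_carrier[OF f] f
    by (auto simp: triple_map_def bornologous_def cube_triple_def rel_space_def cube_sc_cadj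
        cube_htpy_def)
qed

text \<open>By \<open>sc_prod_Pow\<close> the product with the line is again a powerset, that of all
  pairs adjacent both in space and in time. Asking for \<open>1 \<le> N\<close> supplies the strict
  inequality between the two time bounds.\<close>

lemma homotopic_iff: "triple_homotopic (cube_triple n m) T f g \<longleftrightarrow> htpic V A p n m f g"
proof
  assume "triple_homotopic (cube_triple n m) T f g"
  then obtain H M N where
    b: "bornologous (cube n m \<times> UNIV) (sc_prod (cube_sc n m) int_sc) X V H" and
    H: "\<forall>x\<in>cube n m. \<forall>k\<le>M. H (x, k) = f x" "\<forall>x\<in>cube n m. \<forall>k\<ge>N. H (x, k) = g x"
      "H ` (cube_bd n m \<times> UNIV) \<subseteq> A" "H ` (cube_J n m \<times> UNIV) \<subseteq> {p}"
    unfolding triple_homotopic_def cube_triple_def rel_space_def by auto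
  have "cube_htpy V A p n m (\<lambda>x k. H (x, k))"
  proof (rule cube_htpyI)
    show "map_prod H H ` sc_box {(x, y). cadj n m x y} {(a, b). \<bar>a - b\<bar> \<le> 1} \<in> V"
      using b by (auto simp: bornologous_def cube_sc_cadj int_sc_def sc_prod_Pow)
    show "(H (x, k), H (y, l)) \<in> map_prod H H ` sc_box {(x, y). cadj n m x y} {(a, b). \<bar>a - b\<bar> \<le> 1}"
      if "cadj n m x y" "\<bar>k - l\<bar> \<le> 1" for x y k l
      using that by (intro image_eqI[where x = "((x, k), (y, l))"]) (auto simp: sc_box_def)
  qed (use H(3,4) in \<open>auto simp: image_subset_iff\<close>)
  then show "htpic V A p n m f g"
    by (rule htpicI[where M = M and N = N]) (use H in auto)
next
  assume h: "htpic V A p n m f g"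
  then obtain H N where H: "cube_htpy V A p n m H"
    "\<And>x k. x \<in> cube n m \<Longrightarrow> k \<le> 0 \<Longrightarrow> H x k = f x"
    "\<And>x k. x \<in> cube n m \<Longrightarrow> int N \<le> k \<Longrightarrow> H x k = g x" "1 \<le> N"
    by (rule htpicE[where b = 1]) blast
  obtain v where v: "v \<in> V" "\<And>x y k l. cadj n m x y \<Longrightarrow> \<bar>k - l\<bar> \<le> 1 \<Longrightarrow> (H x k, H y l) \<in> v"
    using H(1) by (rule cube_htpyE) blast
  have "bornologous (cube n m \<times> UNIV) (sc_prod (cube_sc n m) int_sc) X V (case_prod H)"
    unfolding bornologous_def cube_sc_cadj int_sc_def sc_prod_Pow
  proof (intro conjI ballI)
    show "case_prod H \<in> cube n m \<times> UNIV \<rightarrow> X"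
      using htpy_carrier[OF H(1)] by auto
    show "map_prod (case_prod H) (case_prod H) ` w \<in> V"
      if "w \<in> Pow (sc_box {(x, y). cadj n m x y} {(a, b). \<bar>a - b\<bar> \<le> 1})" for w
      by (rule controlled_subset[OF v(1)]) (use that v(2) in \<open>fastforce simp: sc_box_def\<close>)
  qed
  then show "triple_homotopic (cube_triple n m) T f g"
    unfolding triple_homotopic_def triple_map_iff
    using htpic_map1[OF h] htpic_map2[OF h] H cube_htpy_bd[OF H(1)] cube_htpy_J[OF H(1)]
    by (intro conjI exI[where x = "case_prod H"] exI[where x = 0] exI[where x = "int N"])
       (auto simp: cube_triple_def rel_space_def)
qed

lemma htpic_trans:
  assumes "htpic V A p n m f g" "htpic V A p n m g h"
  shows "htpic V A p n m f h"
proof -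
  obtain H M where H: "cube_htpy V A p n m H" "\<And>x k. x \<in> cube n m \<Longrightarrow> k \<le> 0 \<Longrightarrow> H x k = f x"
    "\<And>x k. x \<in> cube n m \<Longrightarrow> int M \<le> k \<Longrightarrow> H x k = g x"
    using assms(1) by (rule htpicE[where b = 0]) blast
  obtain K N where K: "cube_htpy V A p n m K" "\<And>x k. x \<in> cube n m \<Longrightarrow> k \<le> 0 \<Longrightarrow> K x k = g x"
    "\<And>x k. x \<in> cube n m \<Longrightarrow> int N \<le> k \<Longrightarrow> K x k = h x" "1 \<le> N"
    using assms(2) by (rule htpicE[where b = 1]) blast
  obtain v where v: "v \<in> V" "\<And>x y k l. cadj n m x y \<Longrightarrow> \<bar>k - l\<bar> \<le> 1 \<Longrightarrow> (H x k, H y l) \<in> v"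
    using H(1) by (rule cube_htpyE) blast
  obtain w where w: "w \<in> V" "\<And>x y k l. cadj n m x y \<Longrightarrow> \<bar>k - l\<bar> \<le> 1 \<Longrightarrow> (K x k, K y l) \<in> w"
    using K(1) by (rule cube_htpyE) blast
  define G where "G = (\<lambda>x k. if k \<le> int M then H x k else K x (k - int M))"
  have G: "G x k = K x (k - int M)" if "int M \<le> k" "x \<in> cube n m" for x k
    using that by (auto simp: G_def H K)
  have "cube_htpy V A p n m G"
  proof (rule cube_htpyI[OF controlled_Un[OF v(1) w(1)]])
    fix x y k l assume xy: "cadj n m x y" "\<bar>k - l :: int\<bar> \<le> 1"
    show "(G x k, G y l) \<in> v \<union> w"
    proof (cases "k \<le> int M \<and> l \<le> int M")
      case True
      then show ?thesis using v(2)[OF xy] by (simp add: G_def)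
    next
      case False
      then have "int M \<le> k" "int M \<le> l" using xy by auto
      then show ?thesis
        using w(2)[OF xy(1), of "k - int M" "l - int M"] xy cadjD[OF xy(1)] by (simp add: G)
    qed
  qed (auto simp: G_def cube_htpy_bd[OF H(1)] cube_htpy_bd[OF K(1)] cube_htpy_J[OF H(1)]
      cube_htpy_J[OF K(1)])
  then show ?thesis
    by (rule htpicI[where M = 0 and N = "int M + int N"]) (use K in \<open>auto simp: G_def H(2)\<close>)
qed

section \<open>Elements of the homotopy groups\<close>

lemma htpy_class_eq_iff:
  assumes "cube_map V A p n m f" "cube_map V A p n m g"
  shows "htpy_class (cube_triple n m) T f = htpy_class (cube_triple n m) T g \<longleftrightarrow>
    htpic V A p n m f g"
proof
  assume "htpy_class (cube_triple n m) T f = htpy_class (cube_triple n m) T g"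
  moreover have "htpic V A p n m g g"
    using assms(2) by (rule htpic_eq) simp
  ultimately show "htpic V A p n m f g"
    by (auto simp: htpy_class_def homotopic_iff)
next
  assume h: "htpic V A p n m f g"
  show "htpy_class (cube_triple n m) T f = htpy_class (cube_triple n m) T g"
    using htpic_trans[OF h] htpic_trans[OF htpic_sym[OF h]]
    by (auto simp: htpy_class_def homotopic_iff)
qed

text \<open>The description in \<open>precomp\<close> is well posed because homotopic
  representatives stay homotopic after collapsing.\<close>

lemma precomp_class:
  assumes f: "cube_map V A p (Suc n) m f" and "1 \<le> m" "m \<le> k"
  shows "precomp T (Suc n) m k (htpy_class (cube_triple (Suc n) m) T f) =
    htpy_class (cube_triple (Suc n) k) T (f \<circ> collapse (Suc n) m)"
  unfolding precomp_def triple_map_iff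
proof (rule the_equality)
  fix d
  assume "\<exists>g. cube_map V A p (Suc n) m g \<and>
    htpy_class (cube_triple (Suc n) m) T f = htpy_class (cube_triple (Suc n) m) T g \<and>
    d = htpy_class (cube_triple (Suc n) k) T (g \<circ> collapse (Suc n) m)"
  then obtain g where g: "htpic V A p (Suc n) m f g"
    "d = htpy_class (cube_triple (Suc n) k) T (g \<circ> collapse (Suc n) m)"
    using htpy_class_eq_iff[OF f] by blast
  have "htpic V A p (Suc n) k (f \<circ> collapse (Suc n) m) (g \<circ> collapse (Suc n) m)"
    using g(1) assms(2,3) by (rule htpic_collapse)
  then show "d = htpy_class (cube_triple (Suc n) k) T (f \<circ> collapse (Suc n) m)"
    using htpy_class_eq_iff htpic_map1 htpic_map2 g(2) by metis
qed (use f in blast)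

lemma collapse_map:
  assumes "cube_map V A p (Suc n) m f" "1 \<le> m" "m \<le> k"
  shows "cube_map V A p (Suc n) k (f \<circ> collapse (Suc n) m)"
  using collapse_htpy[OF assms] by (simp add: o_def)

lemma mem_classes:
  "c \<in> cube_classes T n m \<longleftrightarrow> (\<exists>f. cube_map V A p n m f \<and> c = htpy_class (cube_triple n m) T f)"
  by (auto simp: htpy_classes_def triple_map_iff)

abbreviation "R n \<equiv> dlim_rel (cube_classes T n) (precomp T n)"

lemma dlim_rel_iff:
  assumes f: "cube_map V A p (Suc n) m f" "1 \<le> m" and g: "cube_map V A p (Suc n) l g" "1 \<le> l"
  shows "((m, htpy_class (cube_triple (Suc n) m) T f), (l, htpy_class (cube_triple (Suc n) l) T g))
      \<in> R (Suc n) \<longleftrightarrow>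
    (\<exists>k\<ge>m. l \<le> k \<and>
      htpic V A p (Suc n) k (f \<circ> collapse (Suc n) m) (g \<circ> collapse (Suc n) l))"
proof -
  have "htpy_class (cube_triple (Suc n) m) T f \<in> cube_classes T (Suc n) m"
    "htpy_class (cube_triple (Suc n) l) T g \<in> cube_classes T (Suc n) l"
    using f g by (auto simp: mem_classes)
  moreover have "precomp T (Suc n) m k (htpy_class (cube_triple (Suc n) m) T f) =
      precomp T (Suc n) l k (htpy_class (cube_triple (Suc n) l) T g) \<longleftrightarrow>
    htpic V A p (Suc n) k (f \<circ> collapse (Suc n) m) (g \<circ> collapse (Suc n) l)"
    if "m \<le> k" "l \<le> k" for k
    unfolding precomp_class[OF assms(1,2) that(1)] precomp_class[OF assms(3,4) that(2)]
    by (rule htpy_class_eq_iff[OF collapse_map[OF assms(1,2) that(1)] collapse_map[OF assms(3,4) that(2)]])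
  ultimately show ?thesis
    using assms(2,4) by (auto simp: dlim_rel_def)
qed

lemma equiv_dlim_rel: "equiv (Sigma {1..} (cube_classes T (Suc n))) (R (Suc n))"
proof (rule equivI)
  show "R (Suc n) \<subseteq> Sigma {1..} (cube_classes T (Suc n)) \<times> Sigma {1..} (cube_classes T (Suc n))"
    by (auto simp: dlim_rel_def)
  show "refl_on (Sigma {1..} (cube_classes T (Suc n))) (R (Suc n))"
    by (auto simp: refl_on_def dlim_rel_def)
  show "sym (R (Suc n))"
    by (rule symI) (force simp: dlim_rel_def)
  show "trans (R (Suc n))"
  proof (rule transI)
    fix a b c assume ab: "(a, b) \<in> R (Suc n)" and bc: "(b, c) \<in> R (Suc n)"
    have "\<exists>m f. 1 \<le> m \<and> cube_map V A p (Suc n) m f \<and> x = (m, htpy_class (cube_triple (Suc n) m) T f)"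
      if "x \<in> {a, b, c}" for x
      using ab bc that by (auto simp: dlim_rel_def mem_classes)
    then obtain ma mb mc fa fb fc where
      a: "1 \<le> ma" "cube_map V A p (Suc n) ma fa" "a = (ma, htpy_class (cube_triple (Suc n) ma) T fa)"
      and b: "1 \<le> mb" "cube_map V A p (Suc n) mb fb" "b = (mb, htpy_class (cube_triple (Suc n) mb) T fb)"
      and c: "1 \<le> mc" "cube_map V A p (Suc n) mc fc" "c = (mc, htpy_class (cube_triple (Suc n) mc) T fc)"
      by (metis insertI1 insertI2)
    obtain k where k: "ma \<le> k" "mb \<le> k"
      "htpic V A p (Suc n) k (fa \<circ> collapse (Suc n) ma) (fb \<circ> collapse (Suc n) mb)"
      using ab unfolding a(3) b(3) dlim_rel_iff[OF a(2,1) b(2,1)] by blast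
    obtain l where l: "mb \<le> l" "mc \<le> l"
      "htpic V A p (Suc n) l (fb \<circ> collapse (Suc n) mb) (fc \<circ> collapse (Suc n) mc)"
      using bc unfolding b(3) c(3) dlim_rel_iff[OF b(2,1) c(2,1)] by blast
    \<comment> \<open>A further collapse from a larger side is absorbed, so both homotopies can be
      carried to the common side \<open>max k l\<close> without altering the maps that they
      join.\<close>
    have "(f \<circ> collapse (Suc n) i) \<circ> collapse (Suc n) j = f \<circ> collapse (Suc n) i"
      if "i \<le> j" for i j and f :: "_ \<Rightarrow> 'a"
      using that by (simp add: fun_eq_iff collapse_collapse)
    then have "htpic V A p (Suc n) (max k l) (fa \<circ> collapse (Suc n) ma) (fb \<circ> collapse (Suc n) mb)"
      "htpic V A p (Suc n) (max k l) (fb \<circ> collapse (Suc n) mb) (fc \<circ> collapse (Suc n) mc)"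
      using htpic_collapse[OF k(3), of "max k l"] htpic_collapse[OF l(3), of "max k l"]
        k(1,2) l(1,2) a(1) b(1) by auto
    then have "htpic V A p (Suc n) (max k l) (fa \<circ> collapse (Suc n) ma) (fc \<circ> collapse (Suc n) mc)"
      by (rule htpic_trans)
    then show "(a, c) \<in> R (Suc n)"
      unfolding a(3) c(3) dlim_rel_iff[OF a(2,1) c(2,1)]
      using k(1) l(2) by (intro exI[of _ "max k l"]) auto
  qed
qed

lemma pi_class_eq_iff:
  assumes "cube_map V A p (Suc n) m f" "1 \<le> m" "cube_map V A p (Suc n) l g" "1 \<le> l"
  shows "pi_class T (Suc n) m f = pi_class T (Suc n) l g \<longleftrightarrow>
    (\<exists>k\<ge>m. l \<le> k \<and>
      htpic V A p (Suc n) k (f \<circ> collapse (Suc n) m) (g \<circ> collapse (Suc n) l))"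
  unfolding pi_class_def dlim_rel_iff[OF assms, symmetric]
  using assms by (intro eq_equiv_class_iff[OF equiv_dlim_rel]) (auto simp: mem_classes)

lemma pi_class_htpic:
  assumes "htpic V A p (Suc n) m f g" "1 \<le> m"
  shows "pi_class T (Suc n) m f = pi_class T (Suc n) m g"
  using htpic_map1[OF assms(1)] htpic_map2[OF assms(1)] htpic_collapse[OF assms le_refl] assms(2)
  by (subst pi_class_eq_iff) auto

lemma pi_class_cong:
  assumes "cube_map V A p (Suc n) m f" "\<And>x. x \<in> cube (Suc n) m \<Longrightarrow> f x = g x" "1 \<le> m"
  shows "pi_class T (Suc n) m f = pi_class T (Suc n) m g"
  using htpic_eq[OF assms(1,2)] assms(3) by (rule pi_class_htpic)

lemma pi_class_collapse:
  assumes "cube_map V A p (Suc n) m f" "1 \<le> m" "m \<le> k"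
  shows "pi_class T (Suc n) k (f \<circ> collapse (Suc n) m) = pi_class T (Suc n) m f"
proof (subst pi_class_eq_iff)
  have "(f \<circ> collapse (Suc n) m) \<circ> collapse (Suc n) k = f \<circ> collapse (Suc n) m"
    using assms by (simp add: fun_eq_iff collapse_collapse)
  moreover have "htpic V A p (Suc n) k (f \<circ> collapse (Suc n) m) (f \<circ> collapse (Suc n) m)"
    using collapse_map[OF assms] by (rule htpic_eq) simp
  ultimately show "\<exists>l\<ge>k. m \<le> l \<and> htpic V A p (Suc n) l
      ((f \<circ> collapse (Suc n) m) \<circ> collapse (Suc n) k) (f \<circ> collapse (Suc n) m)"
    using assms(3) by auto
qed (use collapse_map[OF assms] assms in auto)

lemma const_map: "cube_map V A p n m (\<lambda>_. p)"
  by (rule cube_htpyI[OF Id_controlled]) (use base sub in auto)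

lemma pi_one: "1 \<le> m \<Longrightarrow> \<one>\<^bsub>pi_sc (Suc n) T\<^esub> = pi_class T (Suc n) m (\<lambda>_. p)"
  using pi_class_collapse[OF const_map, of 1 m n] by (simp add: pi_sc_def rel_space_def o_def)

lemma pi_class_eq_one_iff:
  assumes "cube_map V A p (Suc n) m f" "1 \<le> m"
  shows "pi_class T (Suc n) m f = \<one>\<^bsub>pi_sc (Suc n) T\<^esub> \<longleftrightarrow>
    (\<exists>k\<ge>m. htpic V A p (Suc n) k (f \<circ> collapse (Suc n) m) (\<lambda>_. p))"
  unfolding pi_one[OF assms(2)] pi_class_eq_iff[OF assms const_map assms(2)] o_def by blast

lemma carrier_pi:
  "a \<in> carrier (pi_sc (Suc n) T) \<longleftrightarrow>
    (\<exists>m f. 1 \<le> m \<and> cube_map V A p (Suc n) m f \<and> a = pi_class T (Suc n) m f)"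
proof -
  have "a \<in> carrier (pi_sc (Suc n) T) \<longleftrightarrow>
    (\<exists>m\<ge>1. \<exists>c\<in>cube_classes T (Suc n) m. a = R (Suc n) `` {(m, c)})"
    by (auto simp: pi_sc_def dlim_def quotient_def)
  then show ?thesis
    by (auto simp: mem_classes pi_class_def Bex_def)
qed

subsection \<open>The product\<close>

text \<open>In dimension at least two the first coordinate is not the last, so its end faces belong
  to \<open>cube_J\<close>. In dimension one they are only boundary points, and the absolute case
  \<open>A = {p}\<close> is what sends them to the basepoint.\<close>

lemma htpy_end_faces:
  assumes "cube_htpy V A p (Suc n) m H" "1 \<le> m" "1 \<le> n \<or> A = {p}"
    "x \<in> cube (Suc n) m" "x 1 \<in> {0, int m}"
  shows "H x k = p"
proof (cases "1 \<le> n")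
  case True
  then have "x \<in> cube_J (Suc n) m"
    using assms(2,4,5) by (auto simp: mem_J_Suc intro: bexI[where x = 1])
  then show ?thesis by (rule cube_htpy_J[OF assms(1)])
next
  case False
  then have "n = 0" by simp
  then have "x \<in> cube_bd (Suc n) m"
    using assms(4,5) by (simp add: mem_bd_Suc)
  then show ?thesis
    using cube_htpy_bd[OF assms(1)] assms(3) False by blast
qed

lemma shift_collapse_cube:
  assumes "x \<in> cube (Suc n) k" "int m \<le> x 1"
  shows "collapse (Suc n) m' (x(1 := x 1 - int m)) \<in> cube (Suc n) m'"
  by (rule collapse_in_cube) (use cube_coord(1)[OF assms(1)] assms(2) in auto)

text \<open>Both halves are the basepoint on the wall where the first coordinate is
  \<open>m\<close>, so they can be glued there. Time is carried along, which yields products of maps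
  and of homotopies at once.\<close>

lemma concat_htpy:
  assumes H: "cube_htpy V A p (Suc n) m H" and m: "1 \<le> m"
    and H': "cube_htpy V A p (Suc n) m' H'" and m': "1 \<le> m'" and n: "1 \<le> n \<or> A = {p}"
  shows "cube_htpy V A p (Suc n) (m + m')
    (\<lambda>x k. cube_concat (Suc n) m m' (\<lambda>x. H x k) (\<lambda>x. H' x k) x)"
proof -
  define G where "G = (\<lambda>x k. cube_concat (Suc n) m m' (\<lambda>x. H x k) (\<lambda>x. H' x k) x)"
  define sh where "sh = (\<lambda>x. collapse (Suc n) m' (x(1 := x 1 - int m)))"
  have left: "G x k = H (collapse (Suc n) m x) k" if "x 1 \<le> int m" for x k
    using that by (simp add: G_def cube_concat_def)
  \<comment> \<open>\<open>cube_concat\<close> assigns the wall \<open>x 1 = m\<close> to the left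
    half; the right formula is extended to it, so that adjacent points always share a
    formula.\<close>
  have right: "G x k = H' (sh x) k" if x: "x \<in> cube (Suc n) (m + m')" "int m \<le> x 1" for x k
  proof (cases "x 1 = int m")
    case True
    have "H (collapse (Suc n) m x) k = p"
      by (rule htpy_end_faces[OF H m n collapse_cube[OF x(1)]]) (use True in \<open>simp add: collapse_apply\<close>)
    moreover have "H' (sh x) k = p"
      by (rule htpy_end_faces[OF H' m' n])
         (use shift_collapse_cube[OF x] True in \<open>simp_all add: sh_def collapse_apply\<close>)
    ultimately show ?thesis using left[of x k] True by simp
  qed (use x in \<open>simp add: G_def cube_concat_def sh_def\<close>)
  \<comment> \<open>The bound on \<open>x 1\<close> excludes \<open>i = 1\<close>: the face where
    the first coordinate vanishes does not meet the right half.\<close>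
  have sh_face: "sh x i = 0" if "x i = 0" "i \<in> {1..Suc n}" "int m < x 1" for x i
    using that by (auto simp: sh_def collapse_apply)
  have sh_end: "sh x i = int m'" if "x i = int (m + m')" "i \<in> {1..Suc n}" for x i
    using that by (auto simp: sh_def collapse_apply)
  obtain v where v: "v \<in> V" "\<And>x y k l. cadj (Suc n) m x y \<Longrightarrow> \<bar>k - l\<bar> \<le> 1 \<Longrightarrow> (H x k, H y l) \<in> v"
    using H by (rule cube_htpyE) blast
  obtain w where w: "w \<in> V" "\<And>x y k l. cadj (Suc n) m' x y \<Longrightarrow> \<bar>k - l\<bar> \<le> 1 \<Longrightarrow> (H' x k, H' y l) \<in> w"
    using H' by (rule cube_htpyE) blast
  have "cube_htpy V A p (Suc n) (m + m') G"
  proof (rule cube_htpyI[OF controlled_Un[OF v(1) w(1)]])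
    fix x y k l assume xy: "cadj (Suc n) (m + m') x y" "\<bar>k - l :: int\<bar> \<le> 1"
    note cu = cadjD(1,2)[OF xy(1)]
    show "(G x k, G y l) \<in> v \<union> w"
    proof (cases "x 1 \<le> int m \<and> y 1 \<le> int m")
      case True
      then show ?thesis using v(2)[OF cadj_collapse[OF xy(1)] xy(2)] left by simp
    next
      case False
      then have ge: "int m \<le> x 1" "int m \<le> y 1"
        using cadjD(3)[OF xy(1), of 1] by auto
      have "\<bar>sh x i - sh y i\<bar> \<le> 1" if "i \<in> {1..Suc n}" for i
        using cadjD(3)[OF xy(1) that] that by (auto simp: sh_def collapse_apply min_def)
      then have "cadj (Suc n) m' (sh x) (sh y)"
        using shift_collapse_cube[OF cu(1) ge(1)] shift_collapse_cube[OF cu(2) ge(2)]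
        by (simp add: cadj_def sh_def)
      then show ?thesis
        using w(2)[OF _ xy(2)] right[OF cu(1) ge(1)] right[OF cu(2) ge(2)] by simp
    qed
  next
    fix x k assume x: "x \<in> cube_bd (Suc n) (m + m')"
    show "G x k \<in> A"
    proof (cases "x 1 \<le> int m")
      case True
      then show ?thesis
        using cube_htpy_bd[OF H collapse_bd[OF _ x]] by (simp add: left)
    next
      case False
      obtain i where "i \<in> {1..Suc n}" "x i \<in> {0, int (m + m')}"
        using x by (auto simp: cube_bd_def)
      then have "sh x i \<in> {0, int m'}"
        using sh_face[of x i] sh_end[of x i] False by fastforce
      then have "sh x \<in> cube_bd (Suc n) m'"
        using shift_collapse_cube[OF bd_cube[OF x], of m m'] False \<open>i \<in> {1..Suc n}\<close>
        by (auto simp: cube_bd_def sh_def)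
      then show ?thesis
        using cube_htpy_bd[OF H'] right[OF bd_cube[OF x]] False by simp
    qed
  next
    fix x k assume x: "x \<in> cube_J (Suc n) (m + m')"
    show "G x k = p"
    proof (cases "x 1 \<le> int m")
      case True
      then show ?thesis
        using cube_htpy_J[OF H collapse_J[OF m _ x]] by (simp add: left)
    next
      case False
      have cu: "sh x \<in> cube (Suc n) m'"
        using shift_collapse_cube[OF J_cube[OF x], of m m'] False by (simp add: sh_def)
      consider "x (Suc n) = int (m + m')" | i where "i \<in> {1..n}" "x i \<in> {0, int (m + m')}"
        using x m unfolding mem_J_Suc[of "m + m'", OF le_trans[OF m le_add1]] by blast
      then have "sh x \<in> cube_J (Suc n) m'"
      proof cases
        case 1
        then show ?thesis using sh_end[of x "Suc n"] cu m' by (simp add: mem_J_Suc)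
      next
        case 2
        then have "sh x i \<in> {0, int m'}"
          using sh_face[of x i] sh_end[of x i] False by fastforce
        then show ?thesis using cu m' 2(1) by (auto simp: mem_J_Suc)
      qed
      then show ?thesis
        using cube_htpy_J[OF H'] right[OF J_cube[OF x]] False by simp
    qed
  qed
  then show ?thesis by (simp add: G_def)
qed

lemma concat_htpic:
  assumes f: "htpic V A p (Suc n) m f f'" and m: "1 \<le> m"
    and g: "htpic V A p (Suc n) m' g g'" and m': "1 \<le> m'" and n: "1 \<le> n \<or> A = {p}"
  shows "htpic V A p (Suc n) (m + m') (cube_concat (Suc n) m m' f g) (cube_concat (Suc n) m m' f' g')"
proof -
  obtain H M where H: "cube_htpy V A p (Suc n) m H"
    "\<And>x k. x \<in> cube (Suc n) m \<Longrightarrow> k \<le> 0 \<Longrightarrow> H x k = f x"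
    "\<And>x k. x \<in> cube (Suc n) m \<Longrightarrow> int M \<le> k \<Longrightarrow> H x k = f' x"
    using f by (rule htpicE[where b = 0]) blast
  obtain K N where K: "cube_htpy V A p (Suc n) m' K"
    "\<And>x k. x \<in> cube (Suc n) m' \<Longrightarrow> k \<le> 0 \<Longrightarrow> K x k = g x"
    "\<And>x k. x \<in> cube (Suc n) m' \<Longrightarrow> int N \<le> k \<Longrightarrow> K x k = g' x"
    using g by (rule htpicE[where b = 0]) blast
  show ?thesis
    by (rule htpicI[OF concat_htpy[OF H(1) m K(1) m' n], where M = 0 and N = "max (int M) (int N)"])
       (use shift_collapse_cube[of _ n "m + m'" m m'] in
         \<open>auto simp: cube_concat_def collapse_cube H(2,3) K(2,3)\<close>)
qed

text \<open>
  In terms of the first coordinate \<open>s\<close>, the delayed map is obtained from the undelayed one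
  through \<open>min s (max m (s - (k - m)))\<close>; lowering the bound inside the maximum from
  \<open>k + m'\<close> to \<open>m\<close> is a homotopy, since minima and maxima are nonexpansive
  for the sup metric, unlike sums.
\<close>

lemma concat_delay:
  assumes f: "cube_map V A p (Suc n) m f" and m: "1 \<le> m" and k: "m \<le> k"
    and g: "cube_map V A p (Suc n) m' g" and m': "1 \<le> m'" and n: "1 \<le> n \<or> A = {p}"
  shows "htpic V A p (Suc n) (k + m')
    (cube_concat (Suc n) m m' f g \<circ> collapse (Suc n) (m + m'))
    (cube_concat (Suc n) k m' (f \<circ> collapse (Suc n) m) g)"
proof -
  define F where "F = cube_concat (Suc n) m m' f g"
  have F: "cube_map V A p (Suc n) (m + m') F"
    using concat_htpy[OF f m g m' n] by (simp add: F_def)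
  define r where "r = (\<lambda>s t. min s (max (max (int m) (int (k + m') - t)) (s - (int k - int m))))"
  \<comment> \<open>At early times \<open>r\<close> leaves values up to \<open>k + m'\<close>, hence
    the collapse to the domain of \<open>F\<close>.\<close>
  define c where "c = (\<lambda>x t. collapse (Suc n) (m + m') (x(1 := r (x 1) t)))"
  have r_bounds: "0 \<le> r s t" "r s t \<le> s" if "0 \<le> s" for s t
    using that by (auto simp: r_def)
  have r_near: "\<bar>r s t - r s' t'\<bar> \<le> 1" if "\<bar>s - s'\<bar> \<le> 1" "\<bar>t - t'\<bar> \<le> 1" for s s' t t'
    using that unfolding r_def by linarith
  \<comment> \<open>The far end is moved down by at most \<open>k - m\<close>; after the collapse it
    therefore stays on the far face at all times.\<close>
  have r_end: "int (m + m') \<le> r (int (k + m')) t" for t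
    using k by (auto simp: r_def)
  have upd: "x(1 := r (x 1) t) \<in> cube (Suc n) (k + m')" if "x \<in> cube (Suc n) (k + m')" for x t
    using cube_coord[OF that, of 1] r_bounds[of "x 1" t] that by (intro cube_update) auto
  have c_cube: "c x t \<in> cube (Suc n) (m + m')" if "x \<in> cube (Suc n) (k + m')" for x t
    unfolding c_def by (rule collapse_cube[OF upd[OF that]])
  have c_end: "c x t i = int (m + m')" if "x i = int (k + m')" "i \<in> {1..Suc n}" for x t i
    using that r_end[of t] k by (auto simp: c_def collapse_apply)
  have c_zero: "c x t i = 0" if "x i = 0" "i \<in> {1..Suc n}" for x t i
    using that r_bounds[of 0 t] by (auto simp: c_def collapse_apply)
  obtain v where v: "v \<in> V" "\<And>x y. cadj (Suc n) (m + m') x y \<Longrightarrow> (F x, F y) \<in> v"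
    using F by (rule cube_htpyE) (metis abs_zero diff_self zero_le_one)
  have "cube_htpy V A p (Suc n) (k + m') (\<lambda>x t. F (c x t))"
  proof (rule cube_htpyI[OF v(1)])
    fix x y t u assume xy: "cadj (Suc n) (k + m') x y" "\<bar>t - u :: int\<bar> \<le> 1"
    have "cadj (Suc n) (k + m') (x(1 := r (x 1) t)) (y(1 := r (y 1) u))"
      using upd cadjD[OF xy(1)] r_near[OF _ xy(2), of "x 1" "y 1"] by (auto simp: cadj_def)
    then show "(F (c x t), F (c y u)) \<in> v"
      unfolding c_def by (rule v(2)[OF cadj_collapse])
  next
    fix x t assume x: "x \<in> cube_bd (Suc n) (k + m')"
    then obtain i where "i \<in> {1..Suc n}" "c x t i \<in> {0, int (m + m')}"
      using c_end c_zero unfolding cube_bd_def by fastforce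
    then show "F (c x t) \<in> A"
      using c_cube[OF bd_cube[OF x]] by (intro cube_htpy_bd[OF F]) (auto simp: cube_bd_def)
  next
    fix x t assume x: "x \<in> cube_J (Suc n) (k + m')"
    have "1 \<le> k + m'" "1 \<le> m + m'" using m' by auto
    moreover from x have "c x t (Suc n) = int (m + m') \<or> (\<exists>i\<in>{1..n}. c x t i \<in> {0, int (m + m')})"
      using c_end[of x] c_zero[of x] unfolding mem_J_Suc[OF \<open>1 \<le> k + m'\<close>] by fastforce
    ultimately show "F (c x t) = p"
      using c_cube[OF J_cube[OF x]] by (intro cube_htpy_J[OF F]) (simp add: mem_J_Suc)
  qed
  then show ?thesis
  proof (rule htpicI[where M = 0 and N = "int (k + m')"])
    fix x :: "nat \<Rightarrow> int" and t :: int assume x: "x \<in> cube (Suc n) (k + m')" and "t \<le> 0"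
    then have "r (x 1) t = x 1"
      using cube_coord[OF x, of 1] by (auto simp: r_def)
    then show "F (c x t) = (cube_concat (Suc n) m m' f g \<circ> collapse (Suc n) (m + m')) x"
      by (simp add: c_def F_def)
  next
    fix x :: "nat \<Rightarrow> int" and t :: int
    assume x: "x \<in> cube (Suc n) (k + m')" and t: "int (k + m') \<le> t"
    have r: "r (x 1) t = min (x 1) (max (int m) (x 1 - (int k - int m)))"
      using t by (auto simp: r_def)
    show "F (c x t) = cube_concat (Suc n) k m' (f \<circ> collapse (Suc n) m) g x"
    proof (cases "x 1 \<le> int k")
      case True
      \<comment> \<open>For \<open>x 1 \<le> k\<close> the final \<open>r\<close> is the minimum of
        \<open>x 1\<close> and \<open>m\<close>: waiting at \<open>m\<close> is the same as
        collapsing to side \<open>m\<close>. Beyond \<open>k\<close> it is the shift by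
        \<open>k - m\<close>, which makes the second factor start at \<open>k\<close>.\<close>
      have "collapse (Suc n) m (c x t) = collapse (Suc n) m (collapse (Suc n) k x)"
        using True k unfolding c_def r by (auto simp: collapse_def restrict_def fun_eq_iff)
      moreover have "r (x 1) t \<le> int m"
        unfolding r using True k by auto
      then have "c x t 1 \<le> int m"
        by (simp add: c_def collapse_apply)
      ultimately show ?thesis
        using True by (simp add: F_def cube_concat_def)
    next
      case False
      have "x 1 \<le> int (k + m')"
        using cube_coord(2)[OF x] by simp
      moreover have "r (x 1) t = x 1 - int k + int m"
        unfolding r using False k by auto
      ultimately have c1: "c x t 1 = x 1 - int k + int m"
        by (simp add: c_def collapse_apply)
      have "collapse (Suc n) m' ((c x t)(1 := x 1 - int k)) = collapse (Suc n) m' (x(1 := x 1 - int k))"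
        unfolding c_def by (auto simp: collapse_def restrict_def fun_eq_iff)
      then show ?thesis
        using False c1 by (simp add: F_def cube_concat_def)
    qed
  qed
qed

text \<open>The two factors behave differently. Enlarging the cube of \<open>g\<close> extends the
  product at its outer end and is an equality of functions up to \<open>collapse\<close>; enlarging
  the cube of \<open>f\<close> opens a gap in the middle and needs
  \<open>concat_delay\<close>.\<close>

lemma concat_stable:
  assumes f: "cube_map V A p (Suc n) m f" and m: "1 \<le> m" and k: "m \<le> k"
    and g: "cube_map V A p (Suc n) m' g" and m': "1 \<le> m'" and k': "m' \<le> k'"
    and n: "1 \<le> n \<or> A = {p}"
  shows "pi_class T (Suc n) (k + k')
      (cube_concat (Suc n) k k' (f \<circ> collapse (Suc n) m) (g \<circ> collapse (Suc n) m')) =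
    pi_class T (Suc n) (m + m') (cube_concat (Suc n) m m' f g)"
proof -
  let ?f = "f \<circ> collapse (Suc n) m"
  have fk: "cube_map V A p (Suc n) k ?f" and k1: "1 \<le> k"
    using collapse_map[OF f m k] m k by auto
  have "cube_concat (Suc n) k k' ?f (g \<circ> collapse (Suc n) m') =
      cube_concat (Suc n) k m' ?f g \<circ> collapse (Suc n) (k + m')"
  proof
    fix x
    have "collapse (Suc n) k (collapse (Suc n) (k + m') x) = collapse (Suc n) k x"
      by (simp add: collapse_collapse)
    moreover have "collapse (Suc n) m' (collapse (Suc n) k' (x(1 := x 1 - int k))) =
        collapse (Suc n) m' ((collapse (Suc n) (k + m') x)(1 := collapse (Suc n) (k + m') x 1 - int k))"
      using k' by (auto simp: collapse_def restrict_def fun_eq_iff)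
    \<comment> \<open>Since \<open>m' \<ge> 1\<close>, the cap \<open>k + m'\<close> lies strictly
      above the threshold \<open>k\<close> and does not affect the comparison.\<close>
    moreover have "collapse (Suc n) (k + m') x 1 \<le> int k \<longleftrightarrow> x 1 \<le> int k"
      using m' by (auto simp: collapse_apply)
    ultimately show "cube_concat (Suc n) k k' ?f (g \<circ> collapse (Suc n) m') x =
      (cube_concat (Suc n) k m' ?f g \<circ> collapse (Suc n) (k + m')) x"
      by (simp add: cube_concat_def)
  qed
  moreover have "pi_class T (Suc n) (k + k') (cube_concat (Suc n) k m' ?f g \<circ> collapse (Suc n) (k + m')) =
      pi_class T (Suc n) (k + m') (cube_concat (Suc n) k m' ?f g)"
    using concat_htpy[OF fk k1 g m' n] m' k' by (intro pi_class_collapse) (auto simp: o_def)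
  moreover have "pi_class T (Suc n) (k + m') (cube_concat (Suc n) m m' f g \<circ> collapse (Suc n) (m + m')) =
      pi_class T (Suc n) (k + m') (cube_concat (Suc n) k m' ?f g)"
    using concat_delay[OF f m k g m' n] m' by (intro pi_class_htpic) auto
  moreover have "pi_class T (Suc n) (k + m') (cube_concat (Suc n) m m' f g \<circ> collapse (Suc n) (m + m')) =
      pi_class T (Suc n) (m + m') (cube_concat (Suc n) m m' f g)"
    using concat_htpy[OF f m g m' n] m k by (intro pi_class_collapse) auto
  ultimately show ?thesis by simp
qed

text \<open>\<open>concat_stable\<close> brings each factor to a side where its two representatives
  are homotopic; there \<open>concat_htpic\<close> multiplies the homotopies.\<close>

lemma concat_well_defined:
  assumes f: "cube_map V A p (Suc n) m f" and m: "1 \<le> m"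
    and f': "cube_map V A p (Suc n) l f'" and l: "1 \<le> l"
    and g: "cube_map V A p (Suc n) m' g" and m': "1 \<le> m'"
    and g': "cube_map V A p (Suc n) l' g'" and l': "1 \<le> l'"
    and n: "1 \<le> n \<or> A = {p}"
    and ff': "pi_class T (Suc n) m f = pi_class T (Suc n) l f'"
    and gg': "pi_class T (Suc n) m' g = pi_class T (Suc n) l' g'"
  shows "pi_class T (Suc n) (m + m') (cube_concat (Suc n) m m' f g) =
    pi_class T (Suc n) (l + l') (cube_concat (Suc n) l l' f' g')"
proof -
  obtain k where k: "m \<le> k" "l \<le> k"
    "htpic V A p (Suc n) k (f \<circ> collapse (Suc n) m) (f' \<circ> collapse (Suc n) l)"
    using ff' unfolding pi_class_eq_iff[OF f m f' l] by blast
  obtain k' where k': "m' \<le> k'" "l' \<le> k'"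
    "htpic V A p (Suc n) k' (g \<circ> collapse (Suc n) m') (g' \<circ> collapse (Suc n) l')"
    using gg' unfolding pi_class_eq_iff[OF g m' g' l'] by blast
  have k1: "1 \<le> k" "1 \<le> k'" "1 \<le> k + k'"
    using m k m' k' by auto
  show ?thesis
    using concat_stable[OF f m k(1) g m' k'(1) n] concat_stable[OF f' l k(2) g' l' k'(2) n]
      pi_class_htpic[OF concat_htpic[OF k(3) k1(1) k'(3) k1(2) n] k1(3)] by simp
qed

lemma pi_mult:
  assumes f: "cube_map V A p (Suc n) m f" and m: "1 \<le> m"
    and g: "cube_map V A p (Suc n) m' g" and m': "1 \<le> m'" and n: "1 \<le> n \<or> A = {p}"
  shows "pi_class T (Suc n) m f \<otimes>\<^bsub>pi_sc (Suc n) T\<^esub> pi_class T (Suc n) m' g =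
    pi_class T (Suc n) (m + m') (cube_concat (Suc n) m m' f g)"
  unfolding pi_sc_def monoid.simps triple_map_iff
proof (rule the_equality)
  fix c
  assume "\<exists>l\<ge>1. \<exists>l'\<ge>1. \<exists>f' g'. cube_map V A p (Suc n) l f' \<and> cube_map V A p (Suc n) l' g' \<and>
    pi_class T (Suc n) m f = pi_class T (Suc n) l f' \<and>
    pi_class T (Suc n) m' g = pi_class T (Suc n) l' g' \<and>
    c = pi_class T (Suc n) (l + l') (cube_concat (Suc n) l l' f' g')"
  then show "c = pi_class T (Suc n) (m + m') (cube_concat (Suc n) m m' f g)"
    using concat_well_defined[OF f m _ _ g m' _ _ n] by metis
qed (use assms in blast)

end

text \<open>Both inclusions have the identity as underlying function, so it is enough that
  homotopies for the first pair are homotopies for the second. This serves \<open>i\<close> and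
  \<open>j\<close> alike.\<close>

lemma pi_induced_class:
  assumes S: "pointed_pair X V A p" and T: "pointed_pair X' V' A' p'"
    and imp: "\<And>n m H. cube_htpy V A p n m H \<Longrightarrow> cube_htpy V' A' p' n m H"
    and f: "cube_map V A p (Suc n) m f" and m: "1 \<le> m"
  shows "pi_induced (Suc n) (rel_space X V A p) (rel_space X' V' A' p') (\<lambda>x. x)
      (pi_class (rel_space X V A p) (Suc n) m f) =
    pi_class (rel_space X' V' A' p') (Suc n) m f"
  unfolding pi_induced_def pointed_pair.triple_map_iff[OF S]
proof (rule the_equality)
  fix c
  assume "\<exists>l\<ge>1. \<exists>h. cube_map V A p (Suc n) l h \<and>
    pi_class (rel_space X V A p) (Suc n) m f = pi_class (rel_space X V A p) (Suc n) l h \<and>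
    c = pi_class (rel_space X' V' A' p') (Suc n) l ((\<lambda>x. x) \<circ> h)"
  then obtain l h where h: "cube_map V A p (Suc n) l h" "1 \<le> l"
    and eq: "pi_class (rel_space X V A p) (Suc n) m f = pi_class (rel_space X V A p) (Suc n) l h"
    and c: "c = pi_class (rel_space X' V' A' p') (Suc n) l h"
    by (auto simp: o_def)
  have "htpic V' A' p' (Suc n) k u w" if "htpic V A p (Suc n) k u w" for k u w
    using that imp unfolding htpic_def by blast
  then have "pi_class (rel_space X' V' A' p') (Suc n) m f = pi_class (rel_space X' V' A' p') (Suc n) l h"
    using eq unfolding pointed_pair.pi_class_eq_iff[OF S f m h]
      pointed_pair.pi_class_eq_iff[OF T imp[OF f] m imp[OF h(1)] h(2)] by blast
  then show "c = pi_class (rel_space X' V' A' p') (Suc n) m f"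
    by (simp add: c)
qed (use f m in \<open>auto simp: o_def\<close>)

section \<open>The boundary map\<close>

text \<open>Points of the cube of dimension \<open>n - 1\<close> are undefined at \<open>n\<close>,
  so \<open>y(n := 0)\<close> embeds that cube as the bottom face.\<close>

definition pi_boundary ::
  "nat \<Rightarrow> 'a sc_triple \<Rightarrow> 'a sc_triple \<Rightarrow>
   (nat \<times> ((nat \<Rightarrow> int) \<Rightarrow> 'a) set) set \<Rightarrow> (nat \<times> ((nat \<Rightarrow> int) \<Rightarrow> 'a) set) set" where
  "pi_boundary n S T a =
     (THE c. \<exists>m\<ge>1. \<exists>f. triple_map (cube_triple n m) S f \<and>
        a = pi_class S n m f \<and> c = pi_class T (n - 1) m (\<lambda>y. f (y(n := 0))))"

context pointed_pair
begin

section \<open>The absolute pairs of \<open>X\<close> and \<open>A\<close>, and restriction to the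
  bottom face\<close>

abbreviation "VA \<equiv> sc_subspace V A"
abbreviation "T0 \<equiv> rel_space X V {p} p"
abbreviation "TA \<equiv> rel_space A VA {p} p"

lemma absolute: "pointed_pair X V {p} p"
  using sc base sub by unfold_locales auto

lemma subspace: "pointed_pair A VA {p} p"
proof
  show "semi_coarse_space A VA"
    unfolding semi_coarse_space_def
  proof (intro conjI ballI allI impI)
    show "VA \<subseteq> Pow (A \<times> A)"
      by (auto simp: sc_subspace_def)
    have "Id_on A = Id_on X \<inter> A \<times> A"
      using sub by auto
    then show "Id_on A \<in> VA"
      using Id_controlled by (auto simp: sc_subspace_def)
  next
    fix v w assume "v \<in> VA" "w \<subseteq> v"
    then show "w \<in> VA"
      unfolding sc_subspace_def using controlled_subset by blast
  next
    fix v w assume "v \<in> VA" "w \<in> VA"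
    then obtain v' w' where "v' \<in> V" "w' \<in> V" "v = v' \<inter> A \<times> A" "w = w' \<inter> A \<times> A"
      by (auto simp: sc_subspace_def)
    then have "v \<union> w = (v' \<union> w') \<inter> A \<times> A" "v' \<union> w' \<in> V"
      using controlled_Un by auto
    then show "v \<union> w \<in> VA"
      unfolding sc_subspace_def by blast
  next
    fix v assume "v \<in> VA"
    then obtain v' where "v' \<in> V" "v = v' \<inter> A \<times> A"
      by (auto simp: sc_subspace_def)
    then have "v\<inverse> = v'\<inverse> \<inter> A \<times> A" "v'\<inverse> \<in> V"
      using sc by (auto simp: semi_coarse_space_def)
    then show "v\<inverse> \<in> VA"
      unfolding sc_subspace_def by blast
  qed
qed (use base in auto)

interpretation X0: pointed_pair X V "{p}" p by (rule absolute)
interpretation A0: pointed_pair A VA "{p}" p by (rule subspace)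

lemma relative_htpy: "cube_htpy V {p} p n m H \<Longrightarrow> cube_htpy V A p n m H"
  using base unfolding cube_htpy_def by auto

text \<open>A controlled set of \<open>X\<close> can be cut down to \<open>A \<times> A\<close>.
  Constructions can thus be carried out in \<open>X\<close>, with only the values to be checked
  against \<open>A\<close>.\<close>

lemma subspace_htpy_iff:
  "cube_htpy VA {p} p n m H \<longleftrightarrow> cube_htpy V {p} p n m H \<and> (\<forall>x\<in>cube n m. \<forall>k. H x k \<in> A)"
proof safe
  assume H: "cube_htpy VA {p} p n m H"
  obtain v where v: "v \<in> VA" "\<And>x y k l. cadj n m x y \<Longrightarrow> \<bar>k - l\<bar> \<le> 1 \<Longrightarrow> (H x k, H y l) \<in> v"
    using H by (rule cube_htpyE) blast
  then obtain v' where "v' \<in> V" "v \<subseteq> v'"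
    by (auto simp: sc_subspace_def)
  then show "cube_htpy V {p} p n m H"
    using v(2) cube_htpy_bd[OF H] cube_htpy_J[OF H] by (intro cube_htpyI[of v' V]) auto
  show "H x k \<in> A" if "x \<in> cube n m" for x k
    using A0.htpy_carrier[OF H that] .
next
  assume H: "cube_htpy V {p} p n m H" and HA: "\<forall>x\<in>cube n m. \<forall>k. H x k \<in> A"
  obtain v where v: "v \<in> V" "\<And>x y k l. cadj n m x y \<Longrightarrow> \<bar>k - l\<bar> \<le> 1 \<Longrightarrow> (H x k, H y l) \<in> v"
    using H by (rule cube_htpyE) blast
  have "v \<inter> A \<times> A \<in> VA"
    using v(1) by (auto simp: sc_subspace_def)
  then show "cube_htpy VA {p} p n m H"
    by (rule cube_htpyI) (use v(2) HA cadjD(1,2) cube_htpy_bd[OF H] cube_htpy_J[OF H] in auto)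
qed

lemma include_class:
  assumes "cube_map VA {p} p (Suc n) m f" "1 \<le> m"
  shows "pi_induced (Suc n) TA T0 (\<lambda>x. x) (pi_class TA (Suc n) m f) = pi_class T0 (Suc n) m f"
  by (rule pi_induced_class[OF subspace absolute _ assms]) (simp add: subspace_htpy_iff)

lemma relativise_class:
  assumes "cube_map V {p} p (Suc n) m f" "1 \<le> m"
  shows "pi_induced (Suc n) T0 T (\<lambda>x. x) (pi_class T0 (Suc n) m f) = pi_class T (Suc n) m f"
  by (rule pi_induced_class[OF absolute pointed_pair_axioms relative_htpy assms])

text \<open>The bottom face lies in the boundary, which gives values in \<open>A\<close>; its own
  boundary lies in \<open>cube_J\<close>, which gives the basepoint.\<close>

lemma face_htpy:
  assumes H: "cube_htpy V A p (Suc n) m H" and m: "1 \<le> m"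
  shows "cube_htpy VA {p} p n m (\<lambda>y. H (y(Suc n := 0)))"
  unfolding subspace_htpy_iff
proof (intro conjI ballI allI)
  obtain v where v: "v \<in> V" "\<And>x y k l. cadj (Suc n) m x y \<Longrightarrow> \<bar>k - l\<bar> \<le> 1 \<Longrightarrow> (H x k, H y l) \<in> v"
    using H by (rule cube_htpyE) blast
  have J: "y(Suc n := 0) \<in> cube_J (Suc n) m" if "y \<in> cube_bd n m" for y
    using that m by (auto simp: mem_J_Suc cube_bd_def cube_extend)
  show "cube_htpy V {p} p n m (\<lambda>y. H (y(Suc n := 0)))"
    by (rule cube_htpyI[OF v(1)])
       (use J J_bd in \<open>auto intro!: v(2) cadj_extend cube_htpy_J[OF H]\<close>)
  show "H (y(Suc n := 0)) k \<in> A" if "y \<in> cube n m" for y k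
    using that by (intro cube_htpy_bd[OF H]) (simp add: mem_bd_Suc cube_extend)
qed

text \<open>Inserting the coordinate \<open>0\<close> commutes with \<open>collapse\<close>, and
  \<open>face_htpy\<close> restricts relative homotopies, so the description determines one class.
  Two successors give the face positive dimension, as the limit lemmas require.\<close>

lemma boundary_class:
  assumes f: "cube_map V A p (Suc (Suc n)) m f" and m: "1 \<le> m"
  shows "pi_boundary (Suc (Suc n)) T TA (pi_class T (Suc (Suc n)) m f) =
    pi_class TA (Suc n) m (\<lambda>y. f (y(Suc (Suc n) := 0)))"
  unfolding pi_boundary_def triple_map_iff diff_Suc_1
proof (rule the_equality)
  fix c
  assume "\<exists>l\<ge>1. \<exists>g. cube_map V A p (Suc (Suc n)) l g \<and>
    pi_class T (Suc (Suc n)) m f = pi_class T (Suc (Suc n)) l g \<and>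
    c = pi_class TA (Suc n) l (\<lambda>y. g (y(Suc (Suc n) := 0)))"
  then obtain l g where l: "1 \<le> l" and g: "cube_map V A p (Suc (Suc n)) l g"
    and eq: "pi_class T (Suc (Suc n)) m f = pi_class T (Suc (Suc n)) l g"
    and c: "c = pi_class TA (Suc n) l (\<lambda>y. g (y(Suc (Suc n) := 0)))"
    by blast
  obtain k where k: "m \<le> k" "l \<le> k" and h: "htpic V A p (Suc (Suc n)) k
      (f \<circ> collapse (Suc (Suc n)) m) (g \<circ> collapse (Suc (Suc n)) l)"
    using eq unfolding pi_class_eq_iff[OF f m g l] by blast
  obtain H N where H: "cube_htpy V A p (Suc (Suc n)) k H"
    "\<And>x t. x \<in> cube (Suc (Suc n)) k \<Longrightarrow> t \<le> 0 \<Longrightarrow> H x t = (f \<circ> collapse (Suc (Suc n)) m) x"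
    "\<And>x t. x \<in> cube (Suc (Suc n)) k \<Longrightarrow> int N \<le> t \<Longrightarrow> H x t = (g \<circ> collapse (Suc (Suc n)) l) x"
    using h by (rule htpicE[where b = 0]) blast
  have k1: "1 \<le> k" using m k by simp
  have "htpic VA {p} p (Suc n) k ((\<lambda>y. f (y(Suc (Suc n) := 0))) \<circ> collapse (Suc n) m)
      ((\<lambda>y. g (y(Suc (Suc n) := 0))) \<circ> collapse (Suc n) l)"
    by (rule htpicI[OF face_htpy[OF H(1) k1], where M = 0 and N = "int N"])
       (auto simp: H(2,3) cube_extend collapse_extend)
  then show "c = pi_class TA (Suc n) m (\<lambda>y. f (y(Suc (Suc n) := 0)))"
    unfolding c using k A0.pi_class_eq_iff[OF face_htpy[OF f m] m face_htpy[OF g l] l] by metis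
qed (use f m in blast)

lemma boundary_hom:
  "pi_boundary (Suc (Suc n)) T TA \<in> hom (pi_sc (Suc (Suc n)) T) (pi_sc (Suc n) TA)"
proof (rule homI)
  fix a assume "a \<in> carrier (pi_sc (Suc (Suc n)) T)"
  then obtain m f where m: "1 \<le> m" and f: "cube_map V A p (Suc (Suc n)) m f"
    and a: "a = pi_class T (Suc (Suc n)) m f"
    by (auto simp: carrier_pi)
  show "pi_boundary (Suc (Suc n)) T TA a \<in> carrier (pi_sc (Suc n) TA)"
    unfolding A0.carrier_pi a boundary_class[OF f m]
    by (intro exI conjI) (rule m, rule face_htpy[OF f m], rule refl)
next
  fix a b assume "a \<in> carrier (pi_sc (Suc (Suc n)) T)" "b \<in> carrier (pi_sc (Suc (Suc n)) T)"
  then obtain m f l g where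
    m: "1 \<le> m" and f: "cube_map V A p (Suc (Suc n)) m f" and a: "a = pi_class T (Suc (Suc n)) m f"
    and l: "1 \<le> l" and g: "cube_map V A p (Suc (Suc n)) l g" and b: "b = pi_class T (Suc (Suc n)) l g"
    by (auto simp: carrier_pi)
  \<comment> \<open>Concatenation acts on the first coordinate and restriction on the last; they
    commute because these differ in dimension at least two.\<close>
  have face: "cube_concat (Suc (Suc n)) m l f g (y(Suc (Suc n) := 0)) =
      cube_concat (Suc n) m l (\<lambda>y. f (y(Suc (Suc n) := 0))) (\<lambda>y. g (y(Suc (Suc n) := 0))) y" for y
    by (simp add: cube_concat_def collapse_extend fun_upd_twist[of "Suc (Suc n)" "Suc 0"])
  have "cube_map V A p (Suc (Suc n)) (m + l) (cube_concat (Suc (Suc n)) m l f g)"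
    using concat_htpy[OF f m g l] by simp
  then show "pi_boundary (Suc (Suc n)) T TA (a \<otimes>\<^bsub>pi_sc (Suc (Suc n)) T\<^esub> b) =
    pi_boundary (Suc (Suc n)) T TA a \<otimes>\<^bsub>pi_sc (Suc n) TA\<^esub> pi_boundary (Suc (Suc n)) T TA b"
    using m l boundary_class[OF f m] boundary_class[OF g l]
    by (simp add: a b pi_mult[OF f m g l] boundary_class face
        A0.pi_mult[OF face_htpy[OF f m] m face_htpy[OF g l] l])
qed

section \<open>Exactness\<close>

text \<open>A relative map contracts its bottom face in \<open>X\<close> by sliding up to the top
  face, which lies in \<open>cube_J\<close>. Conversely a contraction in \<open>X\<close>, with time
  taken as last coordinate, is a relative map: its bottom has values in \<open>A\<close> and its
  other faces are the basepoint.\<close>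

lemma exact_at_subspace:
  "pi_boundary (Suc (Suc n)) T TA ` carrier (pi_sc (Suc (Suc n)) T) =
    kernel (pi_sc (Suc n) TA) (pi_sc (Suc n) T0) (pi_induced (Suc n) TA T0 (\<lambda>x. x))"
proof (intro equalityI subsetI)
  fix b assume "b \<in> pi_boundary (Suc (Suc n)) T TA ` carrier (pi_sc (Suc (Suc n)) T)"
  then obtain m f where m: "1 \<le> m" and f: "cube_map V A p (Suc (Suc n)) m f"
    and b: "b = pi_class TA (Suc n) m (\<lambda>y. f (y(Suc (Suc n) := 0)))"
    by (auto simp: carrier_pi boundary_class)
  define h where "h = (\<lambda>y. f (y(Suc (Suc n) := 0)))"
  have h: "cube_map VA {p} p (Suc n) m h"
    using face_htpy[OF f m] by (simp add: h_def)
  \<comment> \<open>Time runs over all integers, so it is clamped to the range of the last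
    coordinate.\<close>
  define c where "c = (\<lambda>y t. y(Suc (Suc n) := max 0 (min (int m) t)))"
  obtain v where v: "v \<in> V" "\<And>x y. cadj (Suc (Suc n)) m x y \<Longrightarrow> (f x, f y) \<in> v"
    using f by (rule cube_htpyE) (metis abs_zero diff_self zero_le_one)
  have J: "c y t \<in> cube_J (Suc (Suc n)) m" if "y \<in> cube_bd (Suc n) m \<or> y \<in> cube (Suc n) m \<and> int m \<le> t" for y t
  proof -
    have "c y t \<in> cube (Suc (Suc n)) m"
      using that bd_cube unfolding c_def by (intro cube_extend) auto
    moreover have "c y t (Suc (Suc n)) = int m \<or> (\<exists>i\<in>{1..Suc n}. c y t i \<in> {0, int m})"
      using that unfolding c_def cube_bd_def by auto
    ultimately show ?thesis using m by (simp add: mem_J_Suc)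
  qed
  have "cube_htpy V {p} p (Suc n) m (\<lambda>y t. f (c y t))"
  proof (rule cube_htpyI[OF v(1)])
    show "(f (c x k), f (c y l)) \<in> v" if "cadj (Suc n) m x y" "\<bar>k - l\<bar> \<le> 1" for x y k l
      unfolding c_def by (rule v(2)[OF cadj_extend]) (use that in auto)
    show "f (c x k) \<in> {p}" if "x \<in> cube_bd (Suc n) m" for x k
      using cube_htpy_J[OF f J] that by blast
    show "f (c x k) = p" if "x \<in> cube_J (Suc n) m" for x k
      using cube_htpy_J[OF f J] J_bd[OF that] by blast
  qed
  then have "htpic V {p} p (Suc n) m h (\<lambda>_. p)"
  proof (rule htpicI[where M = 0 and N = "int m"])
    show "f (c y t) = h y" if "t \<le> 0" for y t
      using that by (simp add: h_def c_def)
    show "f (c y t) = p" if "y \<in> cube (Suc n) m" "int m \<le> t" for y t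
      using cube_htpy_J[OF f J] that by blast
  qed
  then have "pi_class T0 (Suc n) m h = \<one>\<^bsub>pi_sc (Suc n) T0\<^esub>"
    unfolding X0.pi_one[OF m] using m by (rule X0.pi_class_htpic)
  then show "b \<in> kernel (pi_sc (Suc n) TA) (pi_sc (Suc n) T0) (pi_induced (Suc n) TA T0 (\<lambda>x. x))"
    using h m include_class[OF h m] unfolding kernel_def A0.carrier_pi b h_def[symmetric] by auto
next
  fix b assume "b \<in> kernel (pi_sc (Suc n) TA) (pi_sc (Suc n) T0) (pi_induced (Suc n) TA T0 (\<lambda>x. x))"
  then obtain m h where m: "1 \<le> m" and h: "cube_map VA {p} p (Suc n) m h"
    and b: "b = pi_class TA (Suc n) m h" and one: "pi_class T0 (Suc n) m h = \<one>\<^bsub>pi_sc (Suc n) T0\<^esub>"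
    unfolding kernel_def A0.carrier_pi using include_class by auto
  have h0: "cube_map V {p} p (Suc n) m h" and hA: "\<And>y. y \<in> cube (Suc n) m \<Longrightarrow> h y \<in> A"
    using h by (auto simp: subspace_htpy_iff)
  obtain k where k: "m \<le> k" and hk: "htpic V {p} p (Suc n) k (h \<circ> collapse (Suc n) m) (\<lambda>_. p)"
    using one unfolding X0.pi_class_eq_one_iff[OF h0 m] by blast
  \<comment> \<open>The side \<open>L\<close> has two tasks: being at least \<open>k\<close>, it
    lets \<open>collapse\<close> take faces to faces, and being at least the duration of
    \<open>H\<close>, it puts the final value \<open>p\<close> on the top face.\<close>
  obtain H L where H: "cube_htpy V {p} p (Suc n) k H"
    and H0: "\<And>x t. x \<in> cube (Suc n) k \<Longrightarrow> t \<le> 0 \<Longrightarrow> H x t = (h \<circ> collapse (Suc n) m) x"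
    and H1: "\<And>x t. x \<in> cube (Suc n) k \<Longrightarrow> int L \<le> t \<Longrightarrow> H x t = p" and L: "k \<le> L"
    using hk by (rule htpicE[where b = k]) blast
  have L1: "1 \<le> L" using m k L by simp
  define f where "f = (\<lambda>x. H (collapse (Suc n) k x) (x (Suc (Suc n))))"
  obtain v where v: "v \<in> V" "\<And>x y k' l. cadj (Suc n) k x y \<Longrightarrow> \<bar>k' - l\<bar> \<le> 1 \<Longrightarrow> (H x k', H y l) \<in> v"
    using H by (rule cube_htpyE) blast
  have side: "f x = p" if "x \<in> cube (Suc (Suc n)) L" "i \<in> {1..Suc n}" "x i \<in> {0, int L}" for x i
  proof -
    have "collapse (Suc n) k x \<in> cube_bd (Suc n) k"
      using collapse_face[OF L, of i "Suc n" x] that(3) that(2) collapse_cube_Suc[OF that(1)]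
      by (auto simp: cube_bd_def)
    then show ?thesis
      using cube_htpy_bd[OF H] by (simp add: f_def)
  qed
  have f: "cube_map V A p (Suc (Suc n)) L f"
  proof (rule cube_htpyI[OF v(1)])
    show "(f x, f y) \<in> v" if "cadj (Suc (Suc n)) L x y" for x y
      unfolding f_def using cadjD(3)[OF that] by (intro v(2) cadj_collapse_Suc[OF that]) simp
  next
    fix x assume x: "x \<in> cube_J (Suc (Suc n)) L"
    then consider "x (Suc (Suc n)) = int L" | i where "i \<in> {1..Suc n}" "x i \<in> {0, int L}"
      unfolding mem_J_Suc[OF L1] by blast
    then show "f x = p"
    proof cases
      case 1
      then show ?thesis
        using H1 collapse_cube_Suc[OF J_cube[OF x]] by (simp add: f_def)
    qed (rule side[OF J_cube[OF x]])
  next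
    fix x assume x: "x \<in> cube_bd (Suc (Suc n)) L"
    note cu = collapse_cube_Suc[OF bd_cube[OF x]]
    consider "x (Suc (Suc n)) = int L" | "x (Suc (Suc n)) = 0" | i where "i \<in> {1..Suc n}" "x i \<in> {0, int L}"
      using x unfolding mem_bd_Suc by blast
    then show "f x \<in> A"
    proof cases
      case 1
      then show ?thesis using H1 cu base by (simp add: f_def)
    next
      case 2
      then show ?thesis using H0 cu hA[OF collapse_cube[OF cu]] by (simp add: f_def)
    next
      case 3
      then show ?thesis using side[OF bd_cube[OF x]] base by simp
    qed
  qed
  have "pi_boundary (Suc (Suc n)) T TA (pi_class T (Suc (Suc n)) L f) =
      pi_class TA (Suc n) L (\<lambda>y. f (y(Suc (Suc n) := 0)))"
    by (rule boundary_class[OF f L1])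
  also have "\<dots> = pi_class TA (Suc n) L (h \<circ> collapse (Suc n) m)"
    by (rule A0.pi_class_cong[OF face_htpy[OF f L1] _ L1])
       (use k in \<open>auto simp: f_def H0 collapse_ignore collapse_cube collapse_collapse\<close>)
  also have "\<dots> = b"
    unfolding b using k L by (intro A0.pi_class_collapse[OF h m]) auto
  finally show "b \<in> pi_boundary (Suc (Suc n)) T TA ` carrier (pi_sc (Suc (Suc n)) T)"
    using f L1 carrier_pi by blast
qed

text \<open>A map into \<open>A\<close> may be pushed up to the top face, since the moving bottom
  face only has to remain in \<open>A\<close>. Conversely the bottom face of a relative contraction
  sweeps out values in \<open>A\<close>; reading time as last coordinate there produces the map
  \<open>g\<close> into \<open>A\<close>.\<close>

lemma exact_at_absolute:
  "pi_induced (Suc n) TA T0 (\<lambda>x. x) ` carrier (pi_sc (Suc n) TA) =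
    kernel (pi_sc (Suc n) T0) (pi_sc (Suc n) T) (pi_induced (Suc n) T0 T (\<lambda>x. x))"
proof (intro equalityI subsetI)
  fix b assume "b \<in> pi_induced (Suc n) TA T0 (\<lambda>x. x) ` carrier (pi_sc (Suc n) TA)"
  then obtain m h where m: "1 \<le> m" and h: "cube_map VA {p} p (Suc n) m h"
    and b: "b = pi_class T0 (Suc n) m h"
    by (auto simp: A0.carrier_pi include_class)
  have h0: "cube_map V {p} p (Suc n) m h" and hA: "\<And>y. y \<in> cube (Suc n) m \<Longrightarrow> h y \<in> A"
    using h by (auto simp: subspace_htpy_iff)
  \<comment> \<open>Raising the last coordinate by a maximum keeps the top face fixed and, by time
    \<open>m\<close>, has taken every point there.\<close>
  define c where "c = (\<lambda>x t. x(Suc n := max (x (Suc n)) (min (int m) t)))"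
  have c_cube: "c x t \<in> cube (Suc n) m" if "x \<in> cube (Suc n) m" for x t
    using cube_coord[OF that, of "Suc n"] that unfolding c_def by (intro cube_update) auto
  obtain v where v: "v \<in> V" "\<And>x y. cadj (Suc n) m x y \<Longrightarrow> (h x, h y) \<in> v"
    using h0 by (rule cube_htpyE) (metis abs_zero diff_self zero_le_one)
  have J: "c x t \<in> cube_J (Suc n) m" if "x \<in> cube_J (Suc n) m \<or> x \<in> cube (Suc n) m \<and> int m \<le> t" for x t
  proof -
    have x: "x \<in> cube (Suc n) m"
      using that J_cube by blast
    have "c x t (Suc n) = int m \<or> (\<exists>i\<in>{1..n}. c x t i \<in> {0, int m})"
      using that cube_coord(2)[OF x, of "Suc n"] unfolding c_def mem_J_Suc[OF m] by auto
    then show ?thesis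
      using c_cube[OF x] m by (simp add: mem_J_Suc)
  qed
  have "cube_htpy V A p (Suc n) m (\<lambda>x t. h (c x t))"
  proof (rule cube_htpyI[OF v(1)])
    fix x y k l assume xy: "cadj (Suc n) m x y" "\<bar>k - l :: int\<bar> \<le> 1"
    have "\<bar>max (x (Suc n)) (min (int m) k) - max (y (Suc n)) (min (int m) l)\<bar> \<le> 1"
      using cadjD(3)[OF xy(1), of "Suc n"] xy(2) by auto
    then have "cadj (Suc n) m (c x k) (c y l)"
      using c_cube[OF cadjD(1)[OF xy(1)]] c_cube[OF cadjD(2)[OF xy(1)]] cadjD(3)[OF xy(1)]
      by (auto simp: cadj_def c_def)
    then show "(h (c x k), h (c y l)) \<in> v"
      by (rule v(2))
  next
    show "h (c x k) \<in> A" if "x \<in> cube_bd (Suc n) m" for x k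
      using hA c_cube bd_cube[OF that] by blast
    show "h (c x k) = p" if "x \<in> cube_J (Suc n) m" for x k
      using cube_htpy_J[OF h0 J] that by blast
  qed
  then have "htpic V A p (Suc n) m h (\<lambda>_. p)"
  proof (rule htpicI[where M = 0 and N = "int m"])
    show "h (c x k) = h x" if "x \<in> cube (Suc n) m" "k \<le> 0" for x k
      using that cube_coord(1)[OF that(1), of "Suc n"] by (simp add: c_def max_absorb1)
    show "h (c x k) = p" if "x \<in> cube (Suc n) m" "int m \<le> k" for x k
      using cube_htpy_J[OF h0 J] that by blast
  qed
  then have "pi_class T (Suc n) m h = \<one>\<^bsub>pi_sc (Suc n) T\<^esub>"
    unfolding pi_one[OF m] using m by (rule pi_class_htpic)
  then show "b \<in> kernel (pi_sc (Suc n) T0) (pi_sc (Suc n) T) (pi_induced (Suc n) T0 T (\<lambda>x. x))"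
    using h0 m relativise_class[OF h0 m] unfolding kernel_def X0.carrier_pi b by auto
next
  fix b assume "b \<in> kernel (pi_sc (Suc n) T0) (pi_sc (Suc n) T) (pi_induced (Suc n) T0 T (\<lambda>x. x))"
  then obtain m f where m: "1 \<le> m" and f: "cube_map V {p} p (Suc n) m f"
    and b: "b = pi_class T0 (Suc n) m f" and one: "pi_class T (Suc n) m f = \<one>\<^bsub>pi_sc (Suc n) T\<^esub>"
    unfolding kernel_def X0.carrier_pi using relativise_class by auto
  obtain k where k: "m \<le> k" and fk: "htpic V A p (Suc n) k (f \<circ> collapse (Suc n) m) (\<lambda>_. p)"
    using one unfolding pi_class_eq_one_iff[OF relative_htpy[OF f] m] by blast
  obtain H L where H: "cube_htpy V A p (Suc n) k H"
    and H0: "\<And>x t. x \<in> cube (Suc n) k \<Longrightarrow> t \<le> 0 \<Longrightarrow> H x t = (f \<circ> collapse (Suc n) m) x"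
    and H1: "\<And>x t. x \<in> cube (Suc n) k \<Longrightarrow> int L \<le> t \<Longrightarrow> H x t = p" and L: "k \<le> L"
    using fk by (rule htpicE[where b = k]) blast
  have k1: "1 \<le> k" and L1: "1 \<le> L" and mL: "m \<le> L" using m k L by auto
  obtain v where v: "v \<in> V" "\<And>x y k' l. cadj (Suc n) k x y \<Longrightarrow> \<bar>k' - l\<bar> \<le> 1 \<Longrightarrow> (H x k', H y l) \<in> v"
    using H by (rule cube_htpyE) blast
  text \<open>
    On the square formed by the last coordinate and time, \<open>H\<close> is the basepoint at the corner
    \<open>(0, 0)\<close> and on the two sides opposite to it. The paths
    \<open>s \<mapsto> (min s a, min s b)\<close> turn from the bottom side, where \<open>H\<close> is \<open>f\<close>,
    to the left side, where \<open>H\<close> takes values in \<open>A\<close>.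
  \<close>
  define u where "u = (\<lambda>x t. x(Suc n := min (x (Suc n)) (max 0 (2 * int L - t))))"
  define G where "G = (\<lambda>x t. H (collapse (Suc n) k (u x t)) (min (x (Suc n)) (max 0 t)))"
  define g where "g = (\<lambda>x. H (collapse (Suc n) k (x(Suc n := 0))) (x (Suc n)))"
  have u_cube: "u x t \<in> cube (Suc n) L" if "x \<in> cube (Suc n) L" for x t
    using cube_coord[OF that, of "Suc n"] that unfolding u_def by (intro cube_update) auto
  have G_bd: "G x t = p" if x: "x \<in> cube_bd (Suc n) L" for x t
  proof -
    note cu = collapse_cube[OF u_cube[OF bd_cube[OF x]], of k t]
    \<comment> \<open>The bounds \<open>2 * L - t\<close> and \<open>t\<close> are never both below
      \<open>L\<close>. At the end of a path, \<open>H\<close> is thus evaluated on the top face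
      while \<open>t \<le> L\<close>, and at time \<open>L\<close>, when it is constant, afterwards.
      At the start both arguments are \<open>0\<close>, where \<open>H\<close> is an absolute map on
      its boundary.\<close>
    consider "x (Suc n) = 0" | "x (Suc n) = int L" "t \<le> int L" | "x (Suc n) = int L" "int L \<le> t"
      | i where "i \<in> {1..n}" "x i \<in> {0, int L}"
      using x unfolding mem_bd_Suc by force
    then show ?thesis
    proof cases
      case 1
      then have "collapse (Suc n) m (collapse (Suc n) k (u x t)) (Suc n) = 0"
        by (simp add: collapse_apply u_def)
      then have "collapse (Suc n) m (collapse (Suc n) k (u x t)) \<in> cube_bd (Suc n) m"
        using collapse_cube[OF cu, of m] by (simp add: mem_bd_Suc)
      then show ?thesis
        using 1 H0[OF cu] cube_htpy_bd[OF f] by (simp add: G_def)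
    next
      case 2
      then have "collapse (Suc n) k (u x t) (Suc n) = int k"
        using L by (simp add: collapse_apply u_def)
      then show ?thesis
        using cu k1 cube_htpy_J[OF H] by (simp add: G_def mem_J_Suc)
    next
      case 3
      then show ?thesis
        using H1[OF cu] by (simp add: G_def)
    next
      case 4
      then have "collapse (Suc n) k (u x t) i \<in> {0, int k}"
        using L by (intro collapse_face) (auto simp: u_def)
      then have "collapse (Suc n) k (u x t) \<in> cube_J (Suc n) k"
        using cu k1 4(1) by (auto simp: mem_J_Suc)
      then show ?thesis
        using cube_htpy_J[OF H] by (simp add: G_def)
    qed
  qed
  have G: "cube_htpy V {p} p (Suc n) L G"
  proof (rule cube_htpyI[OF v(1)])
    fix x y t t' assume xy: "cadj (Suc n) L x y" "\<bar>t - t' :: int\<bar> \<le> 1"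
    have near: "\<bar>x (Suc n) - y (Suc n)\<bar> \<le> 1"
      using cadjD(3)[OF xy(1)] by simp
    then have "\<bar>u x t (Suc n) - u y t' (Suc n)\<bar> \<le> 1"
      using xy(2) unfolding u_def by auto
    then have "cadj (Suc n) L (u x t) (u y t')"
      using u_cube[OF cadjD(1)[OF xy(1)]] u_cube[OF cadjD(2)[OF xy(1)]] cadjD(3)[OF xy(1)]
      by (auto simp: cadj_def u_def)
    then show "(G x t, G y t') \<in> v"
      unfolding G_def using near xy(2) by (intro v(2) cadj_collapse) auto
  qed (use G_bd J_bd in auto)
  have fg: "htpic V {p} p (Suc n) L (f \<circ> collapse (Suc n) m) g"
  proof (rule htpicI[OF G, where M = 0 and N = "2 * int L"])
    fix x :: "nat \<Rightarrow> int" and t :: int assume x: "x \<in> cube (Suc n) L"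
    have s: "0 \<le> x (Suc n)" "x (Suc n) \<le> int L"
      using cube_coord[OF x, of "Suc n"] by auto
    show "G x t = (f \<circ> collapse (Suc n) m) x" if "t \<le> 0"
    proof -
      have "u x t = x"
        using that s by (simp add: u_def min_absorb1)
      then show ?thesis
        using that s k H0[OF collapse_cube[OF x]] by (simp add: G_def collapse_collapse)
    qed
    show "G x t = g x" if "2 * int L \<le> t"
    proof -
      have "u x t = x(Suc n := 0)" "min (x (Suc n)) (max 0 t) = x (Suc n)"
        using that s by (simp_all add: u_def)
      then show ?thesis by (simp add: G_def g_def)
    qed
  qed
  have g: "cube_map VA {p} p (Suc n) L g"
    unfolding subspace_htpy_iff
  proof (intro conjI ballI allI)
    show "cube_map V {p} p (Suc n) L g"
      using fg by (rule htpic_map2)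
    fix x assume x: "x \<in> cube (Suc n) L"
    then have "collapse (Suc n) k (x(Suc n := 0)) \<in> cube (Suc n) k"
      by (intro collapse_cube cube_update) auto
    then show "g x \<in> A"
      unfolding g_def by (intro cube_htpy_bd[OF H]) (simp add: mem_bd_Suc collapse_apply)
  qed
  have "pi_induced (Suc n) TA T0 (\<lambda>x. x) (pi_class TA (Suc n) L g) = pi_class T0 (Suc n) L g"
    by (rule include_class[OF g L1])
  also have "\<dots> = pi_class T0 (Suc n) L (f \<circ> collapse (Suc n) m)"
    using X0.pi_class_htpic[OF fg L1] by simp
  also have "\<dots> = b"
    unfolding b by (rule X0.pi_class_collapse[OF f m mL])
  finally show "b \<in> pi_induced (Suc n) TA T0 (\<lambda>x. x) ` carrier (pi_sc (Suc n) TA)"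
    using g L1 A0.carrier_pi by blast
qed

text \<open>An absolute map is already constant on the bottom face. Conversely, a contraction in
  \<open>A\<close> of the bottom face is attached below as a collar; a relative homotopy may move
  the bottom through it, because its values lie in \<open>A\<close>, until the whole boundary is the
  basepoint.\<close>

lemma exact_at_relative:
  "pi_induced (Suc (Suc n)) T0 T (\<lambda>x. x) ` carrier (pi_sc (Suc (Suc n)) T0) =
    kernel (pi_sc (Suc (Suc n)) T) (pi_sc (Suc n) TA) (pi_boundary (Suc (Suc n)) T TA)"
proof (intro equalityI subsetI)
  fix b assume "b \<in> pi_induced (Suc (Suc n)) T0 T (\<lambda>x. x) ` carrier (pi_sc (Suc (Suc n)) T0)"
  then obtain m f where m: "1 \<le> m" and f: "cube_map V {p} p (Suc (Suc n)) m f"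
    and b: "b = pi_class T (Suc (Suc n)) m f"
    by (auto simp: X0.carrier_pi relativise_class)
  note fr = relative_htpy[OF f]
  have "f (y(Suc (Suc n) := 0)) = p" if "y \<in> cube (Suc n) m" for y
  proof -
    have "y(Suc (Suc n) := 0) \<in> cube_bd (Suc (Suc n)) m"
      using cube_extend[OF that, of 0] by (simp add: mem_bd_Suc)
    then show ?thesis using cube_htpy_bd[OF f] by blast
  qed
  then have "pi_class TA (Suc n) m (\<lambda>y. f (y(Suc (Suc n) := 0))) = \<one>\<^bsub>pi_sc (Suc n) TA\<^esub>"
    unfolding A0.pi_one[OF m] by (intro A0.pi_class_cong[OF face_htpy[OF fr m] _ m])
  then show "b \<in> kernel (pi_sc (Suc (Suc n)) T) (pi_sc (Suc n) TA) (pi_boundary (Suc (Suc n)) T TA)"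
    using fr m boundary_class[OF fr m] unfolding kernel_def carrier_pi b by auto
next
  fix b assume "b \<in> kernel (pi_sc (Suc (Suc n)) T) (pi_sc (Suc n) TA) (pi_boundary (Suc (Suc n)) T TA)"
  then obtain m f where m: "1 \<le> m" and f: "cube_map V A p (Suc (Suc n)) m f"
    and b: "b = pi_class T (Suc (Suc n)) m f"
    and one: "pi_class TA (Suc n) m (\<lambda>y. f (y(Suc (Suc n) := 0))) = \<one>\<^bsub>pi_sc (Suc n) TA\<^esub>"
    unfolding kernel_def carrier_pi using boundary_class by auto
  define e where "e = Suc (Suc n)"
  obtain k where k: "m \<le> k"
    and fk: "htpic VA {p} p (Suc n) k ((\<lambda>y. f (y(e := 0))) \<circ> collapse (Suc n) m) (\<lambda>_. p)"
    using one unfolding A0.pi_class_eq_one_iff[OF face_htpy[OF f m] m] e_def by blast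
  obtain H N where HA: "cube_htpy VA {p} p (Suc n) k H"
    and H0: "\<And>x t. x \<in> cube (Suc n) k \<Longrightarrow> t \<le> 0 \<Longrightarrow>
      H x t = ((\<lambda>y. f (y(e := 0))) \<circ> collapse (Suc n) m) x"
    and H1: "\<And>x t. x \<in> cube (Suc n) k \<Longrightarrow> int N \<le> t \<Longrightarrow> H x t = p"
    using fk by (rule htpicE[where b = 0]) blast
  have H: "cube_htpy V {p} p (Suc n) k H"
    and H_A: "\<And>x t. x \<in> cube (Suc n) k \<Longrightarrow> H x t \<in> A"
    using HA by (auto simp: subspace_htpy_iff)
  \<comment> \<open>The side holds a collar of length \<open>N\<close> with \<open>k\<close> steps
    left for \<open>f\<close>. Even after the full shift the top is read at
    \<open>L - N = k\<close>, where the collapsed \<open>f\<close> has reached its top face.\<close>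
  define L where "L = k + N"
  have L1: "1 \<le> L" and mL: "m \<le> L" and kL: "k \<le> L"
    using m k by (auto simp: L_def)
  obtain v where v: "v \<in> V" "\<And>x y. cadj e m x y \<Longrightarrow> (f x, f y) \<in> v"
    unfolding e_def using f by (rule cube_htpyE) (metis abs_zero diff_self zero_le_one)
  obtain w where w: "w \<in> V" "\<And>x y k' l. cadj (Suc n) k x y \<Longrightarrow> \<bar>k' - l\<bar> \<le> 1 \<Longrightarrow> (H x k', H y l) \<in> w"
    using H by (rule cube_htpyE) blast
  text \<open>
    \<open>F x s\<close> prolongs \<open>f\<close> to negative values \<open>s\<close> of the last coordinate by the
    contraction \<open>H\<close> of its bottom face. In \<open>r\<close> the inner bound \<open>L - t\<close> decreases,
    which first delays \<open>f\<close> by \<open>N\<close> and then lets the delayed map start in the collar.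
  \<close>
  define F where "F = (\<lambda>x s. if 0 \<le> s then f (collapse e m (x(e := s)))
    else H (collapse (Suc n) k x) (- s))"
  define r where "r = (\<lambda>s t. min s (max (int L - t) (s - int N)))"
  define G where "G = (\<lambda>x t. F x (r (x e) t))"
  define g where "g = (\<lambda>x. F x (x e - int N))"
  have upd: "x(e := s) \<in> cube e L" if "x \<in> cube e L" "0 \<le> s" "s \<le> int L" for x s
    using that by (intro cube_update) (auto simp: e_def)
  have cu: "collapse (Suc n) k x \<in> cube (Suc n) k" if "x \<in> cube e L" for x
    using that collapse_cube_Suc by (simp add: e_def)
  \<comment> \<open>The collar formula also holds at \<open>s = 0\<close>, because \<open>H\<close>
    starts at the bottom face of \<open>f\<close>. This is what controls steps across the
    seam.\<close>
  have F_neg: "F x s = H (collapse (Suc n) k x) (- s)" if "x \<in> cube e L" "s \<le> 0" for x s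
  proof (cases "s = 0")
    case True
    then show ?thesis
      using H0[OF cu[OF that(1)], of 0] k
      by (simp add: F_def e_def collapse_extend collapse_collapse)
  qed (use that in \<open>simp add: F_def\<close>)
  have F_control: "(F x s, F y t) \<in> v \<union> w"
    if xy: "cadj e L x y" "\<bar>s - t\<bar> \<le> 1" "s \<le> int L" "t \<le> int L" for x y s t
  proof (cases "0 \<le> s \<and> 0 \<le> t")
    case True
    then have "cadj e L (x(e := s)) (y(e := t))"
      using that by (intro cadj_update) (auto simp: e_def)
    then show ?thesis
      using True v(2)[OF cadj_collapse] by (simp add: F_def)
  next
    case False
    then have "s \<le> 0" "t \<le> 0" using xy(2) by auto
    moreover have "cadj (Suc n) k (collapse (Suc n) k x) (collapse (Suc n) k y)"
      using cadj_collapse_Suc xy(1) by (simp add: e_def)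
    ultimately show ?thesis
      using w(2)[of _ _ "- s" "- t"] xy(2) F_neg cadjD(1,2)[OF xy(1)] by simp
  qed
  have F_side: "F x s = p"
    if x: "x \<in> cube e L" "i \<in> {1..Suc n}" "x i \<in> {0, int L}" "s \<le> int L" for x i s
  proof (cases "0 \<le> s")
    case True
    have "collapse e m (x(e := s)) i \<in> {0, int m}"
      using that by (intro collapse_face[OF mL]) (auto simp: e_def)
    then have "collapse e m (x(e := s)) \<in> cube_J e m"
      using collapse_cube[OF upd[OF x(1) True x(4)], of m] x(2) m
      unfolding e_def by (auto simp: mem_J_Suc)
    then show ?thesis
      using True cube_htpy_J[OF f] by (simp add: F_def e_def)
  next
    case False
    have "collapse (Suc n) k x \<in> cube_bd (Suc n) k"
      using collapse_face[OF kL, of i "Suc n" x] x(3) cu[OF x(1)] x(2) by (auto simp: cube_bd_def)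
    then show ?thesis
      using False cube_htpy_bd[OF H] by (simp add: F_def)
  qed
  \<comment> \<open>As \<open>m \<le> k\<close>, collapsing to side \<open>m\<close> puts every
    level \<open>s \<ge> k\<close> on the top face of \<open>f\<close>.\<close>
  have F_top: "F x s = p" if x: "x \<in> cube e L" "int k \<le> s" "s \<le> int L" for x s
  proof -
    have "collapse e m (x(e := s)) \<in> cube_J e m"
      using collapse_cube[OF upd[OF x(1) _ x(3)], of m] x(2) k m
      unfolding e_def by (simp add: mem_J_Suc collapse_apply)
    then show ?thesis
      using x(2) cube_htpy_J[OF f] by (simp add: F_def e_def)
  qed
  have F_A: "F x s \<in> A" if "x \<in> cube e L" "s \<le> 0" for x s
    using F_neg[OF that] H_A[OF cu[OF that(1)]] by simp
  have coord: "0 \<le> x e" "x e \<le> int L" if "x \<in> cube e L" for x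
    using cube_coord[OF that, of e] by (auto simp: e_def)
  have r_le: "r s t \<le> s" for s t
    by (simp add: r_def)
  have G: "cube_htpy V A p e L G"
  proof (rule cube_htpyI[OF controlled_Un[OF v(1) w(1)]])
    fix x y t t' assume xy: "cadj e L x y" "\<bar>t - t' :: int\<bar> \<le> 1"
    have "\<bar>x e - y e\<bar> \<le> 1"
      using cadjD(3)[OF xy(1)] by (simp add: e_def)
    then have "\<bar>r (x e) t - r (y e) t'\<bar> \<le> 1"
      using xy(2) unfolding r_def by linarith
    then show "(G x t, G y t') \<in> v \<union> w"
      unfolding G_def
      using coord(2)[OF cadjD(1)[OF xy(1)]] coord(2)[OF cadjD(2)[OF xy(1)]] r_le[of "x e" t] r_le[of "y e" t']
      by (intro F_control[OF xy(1)]) auto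
  next
    fix x t assume x: "x \<in> cube_J e L"
    note xc = J_cube[OF x]
    consider "x e = int L" | i where "i \<in> {1..Suc n}" "x i \<in> {0, int L}"
      using x unfolding e_def mem_J_Suc[OF L1] by blast
    then show "G x t = p"
    proof cases
      case 1
      then have "int k \<le> r (x e) t" "r (x e) t \<le> int L"
        by (auto simp: r_def L_def)
      then show ?thesis using F_top[OF xc] by (simp add: G_def)
    next
      case 2
      then show ?thesis
        using F_side[OF xc] r_le[of "x e" t] coord(2)[OF xc] by (simp add: G_def)
    qed
  next
    fix x t assume x: "x \<in> cube_bd e L"
    note xc = bd_cube[OF x]
    consider "x e = int L" | "x e = 0" | i where "i \<in> {1..Suc n}" "x i \<in> {0, int L}"
      using x unfolding e_def mem_bd_Suc by blast
    then show "G x t \<in> A"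
    proof cases
      case 1
      then have "int k \<le> r (x e) t" "r (x e) t \<le> int L"
        by (auto simp: r_def L_def)
      then show ?thesis using F_top[OF xc] base by (simp add: G_def)
    next
      case 2
      then show ?thesis
        using F_A[OF xc] r_le[of 0 t] by (simp add: G_def)
    next
      case 3
      then show ?thesis
        using F_side[OF xc] r_le[of "x e" t] coord(2)[OF xc] base by (simp add: G_def)
    qed
  qed
  have fg: "htpic V A p e L (f \<circ> collapse e m) g"
  \<comment> \<open>From this time on \<open>L - t\<close> is at most \<open>- N\<close>, hence
    below \<open>s - N\<close> for every coordinate \<open>s\<close>, and \<open>r\<close> is the
    full shift.\<close>
  proof (rule htpicI[OF G, where M = 0 and N = "int L + int N"])
    fix x :: "nat \<Rightarrow> int" and t :: int assume x: "x \<in> cube e L"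
    show "G x t = (f \<circ> collapse e m) x" if "t \<le> 0"
    proof -
      have "r (x e) t = x e"
        using that coord[OF x] by (auto simp: r_def)
      then show ?thesis
        using coord[OF x] by (simp add: G_def F_def)
    qed
    show "G x t = g x" if "int L + int N \<le> t"
    proof -
      have "r (x e) t = x e - int N"
        using that coord[OF x] by (auto simp: r_def)
      then show ?thesis
        by (simp add: G_def g_def)
    qed
  qed
  have "cube_map V {p} p e L g"
  proof (rule cube_htpyI[OF controlled_Un[OF v(1) w(1)]])
    show "(g x, g y) \<in> v \<union> w" if xy: "cadj e L x y" for x y
      unfolding g_def
      using coord(2)[OF cadjD(1)[OF xy]] coord(2)[OF cadjD(2)[OF xy]] cadjD(3)[OF xy, of e]
      by (intro F_control[OF xy]) (auto simp: e_def)
    have g_bd: "g x = p" if x: "x \<in> cube_bd e L" for x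
    proof -
      note xc = bd_cube[OF x]
      consider "x e = int L" | "x e = 0" | i where "i \<in> {1..Suc n}" "x i \<in> {0, int L}"
        using x unfolding e_def mem_bd_Suc by blast
      then show ?thesis
      proof cases
        case 1
        then show ?thesis
          using F_top[OF xc] by (simp add: g_def L_def)
      next
        \<comment> \<open>The bottom is read at \<open>- N\<close>, that is, at the end of the
          contraction \<open>H\<close>.\<close>
        case 2
        then show ?thesis
          using F_neg[OF xc] H1[OF cu[OF xc]] by (simp add: g_def)
      next
        case 3
        then show ?thesis
          using F_side[OF xc] coord(2)[OF xc] by (simp add: g_def)
      qed
    qed
    show "g x \<in> {p}" if "x \<in> cube_bd e L" for x
      using g_bd[OF that] by simp
    show "g x = p" if "x \<in> cube_J e L" for x
      using g_bd[OF J_bd[OF that]] .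
  qed
  then have g: "cube_map V {p} p (Suc (Suc n)) L g"
    by (simp add: e_def)
  have "pi_induced (Suc (Suc n)) T0 T (\<lambda>x. x) (pi_class T0 (Suc (Suc n)) L g) =
      pi_class T (Suc (Suc n)) L g"
    by (rule relativise_class[OF g L1])
  also have "\<dots> = pi_class T (Suc (Suc n)) L (f \<circ> collapse (Suc (Suc n)) m)"
    using pi_class_htpic[OF fg[unfolded e_def] L1] by simp
  also have "\<dots> = b"
    unfolding b by (rule pi_class_collapse[OF f m mL])
  finally show "b \<in> pi_induced (Suc (Suc n)) T0 T (\<lambda>x. x) ` carrier (pi_sc (Suc (Suc n)) T0)"
    using g L1 X0.carrier_pi by blast
qed

end

text \<open>\<open>kernel\<close> takes the carrier of its first structure and the unit of its
  second, so the clause for \<open>j\<close> at \<open>n = 1\<close> is exactness at a map into a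
  pointed set.\<close>

theorem theorem3p5p8:
  fixes X A :: "'a set" and V :: "('a \<times> 'a) set set" and p :: 'a
  assumes "semi_coarse_space X V" and "p \<in> A" and "A \<subseteq> X"
  defines "XA \<equiv> rel_space X V A p"
    and "X0 \<equiv> abs_space X V p"
    and "A0 \<equiv> abs_space A (sc_subspace V A) p"
  defines "i \<equiv> \<lambda>n. pi_induced n A0 X0 (\<lambda>x. x)"
    and "j \<equiv> \<lambda>n. pi_induced n X0 XA (\<lambda>x. x)"
  shows "\<exists>d. (\<forall>n\<ge>2. d n \<in> hom (pi_sc n XA) (pi_sc (n - 1) A0)) \<and>
    (\<forall>n\<ge>1. d (n + 1) ` carrier (pi_sc (n + 1) XA) = kernel (pi_sc n A0) (pi_sc n X0) (i n)) \<and>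
    (\<forall>n\<ge>1. i n ` carrier (pi_sc n A0) = kernel (pi_sc n X0) (pi_sc n XA) (j n)) \<and>
    (\<forall>n\<ge>2. j n ` carrier (pi_sc n X0) = kernel (pi_sc n XA) (pi_sc (n - 1) A0) (d n))"
proof -
  interpret pointed_pair X V A p
    using assms(1-3) by unfold_locales
  have two: "\<exists>k. n = Suc (Suc k)" if "2 \<le> n" for n :: nat
    using that by presburger
  have one: "\<exists>k. n = Suc k" if "1 \<le> n" for n :: nat
    using that by presburger
  show ?thesis
    unfolding XA_def X0_def A0_def i_def j_def abs_space_def
  proof (intro exI[where x = "\<lambda>n. pi_boundary n T TA"] conjI allI impI)
    fix n :: nat
    show "pi_boundary n T TA \<in> hom (pi_sc n T) (pi_sc (n - 1) TA)" if "2 \<le> n"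
      using two[OF that] boundary_hom by (elim exE) simp
    show "pi_boundary (n + 1) T TA ` carrier (pi_sc (n + 1) T) =
        kernel (pi_sc n TA) (pi_sc n T0) (pi_induced n TA T0 (\<lambda>x. x))" if "1 \<le> n"
      using one[OF that] by (elim exE) (simp add: exact_at_subspace)
    show "pi_induced n TA T0 (\<lambda>x. x) ` carrier (pi_sc n TA) =
        kernel (pi_sc n T0) (pi_sc n T) (pi_induced n T0 T (\<lambda>x. x))" if "1 \<le> n"
      using one[OF that] by (elim exE) (simp add: exact_at_absolute)
    show "pi_induced n T0 T (\<lambda>x. x) ` carrier (pi_sc n T0) =
        kernel (pi_sc n T) (pi_sc (n - 1) TA) (pi_boundary n T TA)" if "2 \<le> n"
      using two[OF that] by (elim exE) (simp add: exact_at_relative)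
  qed
qed

end
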